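(* Let $\mathbb{N}^n$ be the free commutative monoid on generators $a_1,\dots,a_n$, and let $F:(\mathfrak F\mathbb{N}^n)^{op}\to\mathrm{Ab}$ be a contravariant natural system on $\mathbb{N}^n$. Then for all $k\geqslant 0$, $$H_k(\mathbb{N}^n,F)\cong H_k(T^n_*,\overline F).$$
   Context: For a monoid $M$ (viewed as a one-object category), the factorization category $\mathfrak F M$ has the elements of $M$ as objects; a morphism $\alpha\to\beta$ is a pair $(f,g)$ of elements of $M$ with $g\alpha f=\beta$; the composite of $(f_1,g_1):\alpha\to\beta$ and $(f_2,g_2):\beta\to\gamma$ is $(f_1f_2,g_2g_1)$, and the identity is $(1,1)$. A contravariant natural system on $M$ is a functor $F:(\mathfrak FM)^{op}\to\mathrm{Ab}$, and the Leech homology is $H_k(M,F)=\varinjlim{}_k^{(\mathfrak FM)^{op}}F$, where for a small category $\mathcal C$ and $G:\mathcal C\to\mathrm{Ab}$, $\varinjlim{}_k^{\mathcal C}G$ is the $k$-th left derived functor of the colimit (equivalently the $k$-th homology of the complex $\bigoplus_{c_0\to\cdots\to c_k}G(c_0)$ with the standard alternating-face differential). Precubical sets, the category $\Box_+$ with face maps $\delta_i^{k,\varepsilon}$, the category of singular cubes $\Box_+/X$, homological systems and the homology $H_k(X,G)$ of a precubical set with coefficients in a homological system $G:(\Box_+/X)^{op}\to\mathrm{Ab}$ are as follows: $\Box_+$ has objects $\{0,1\}^m$ and morphisms generated by $\delta_i^{m,\varepsilon}$ (insert $\varepsilon$ at position $i$); a precubical set is a functor $X:\Box_+^{op}\to\mathrm{Set}$,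 $X_m=X(\{0,1\}^m)$, $\partial_i^{m,\varepsilon}=X(\delta_i^{m,\varepsilon})$; $\Box_+/X$ has objects the elements $\sigma\in X_m$ and morphisms $(f,\sigma,\tau)$ with $X(f)(\tau)=\sigma$; $H_k(X,G)$ is the homology of $\bigoplus_{\sigma\in X_k}G(\sigma)$ with $d_k=\sum_{i=1}^k(-1)^i(d_i^{k,1}-d_i^{k,0})$, $d_i^{k,\varepsilon}$ sending $G(\sigma)$ to $G(\partial_i^{k,\varepsilon}\sigma)$ via $G(\delta_i^{k,\varepsilon},\partial_i^{k,\varepsilon}\sigma,\sigma)$. The precubical set $T^n_*$ has $T^n_k=\{a_{i_1}a_{i_2}\cdots a_{i_k}:1\leqslant i_1<\dots<i_k\leqslant n\}$ (so $T^n_0=\{1\}$) and $\partial_s^{k,0}(a_{i_1}\cdots a_{i_k})=\partial_s^{k,1}(a_{i_1}\cdots a_{i_k})=a_{i_1}\cdots\widehat{a_{i_s}}\cdots a_{i_k}$. The homological system $\overline F$ on $T^n_*$ is the unique functor $(\Box_+/T^n_* )^{op}\to\mathrm{Ab}$ with $\overline F(a_{i_1}\cdots a_{i_k})=F(a_{i_1}\cdots a_{i_k})$ (the product regarded as an element of $\mathbb N^n$) and sending the face morphism $(\delta_s^{k,0},a_{i_1}\cdots\widehat{a_{i_s}}\cdots a_{i_k},a_{i_1}\cdots a_{i_k})$ to $F$ of the morphism $(a_{i_s},1):a_{i_1}\cdots\widehat{a_{i_s}}\cdots a_{i_k}\to a_{i_1}\cdots a_{i_k}$ of $\mathfrak F\mathbb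 N^n$, and the face morphism with $\delta_s^{k,1}$ to $F$ of the morphism $(1,a_{i_s})$. *)

theory Defs
  imports "HOL-Algebra.Product_Groups" "HOL-Algebra.FiniteProduct" "HOL-Library.Function_Algebras"
begin

text \<open>Elements of N^n on generators a_1,...,a_n are functions nat => nat supported on {1..n};
  the monoid operation is pointwise addition (written + ) with unit 0.\<close>

definition NN :: "nat \<Rightarrow> (nat \<Rightarrow> nat) set" where
  "NN n = {\<alpha>. \<forall>i. (i = 0 \<or> n < i) \<longrightarrow> \<alpha> i = 0}"

text \<open>The element a_{i1} ... a_{ik} of N^n attached to a set S = {i1,...,ik}.\<close>
definition ind :: "nat set \<Rightarrow> nat \<Rightarrow> nat" where
  "ind S = (\<lambda>j. if j \<in> S then 1 else 0)"

definition gen :: "nat \<Rightarrow> nat \<Rightarrow> nat" where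
  "gen i = ind {i}"

text \<open>A morphism alpha -> beta of the factorization category F(N^n) is a pair (f,g) with
  g alpha f = beta, i.e. beta = alpha + f + g.  A contravariant natural system consists of an
  abelian group FG alpha for every object and, for every morphism (f,g): alpha -> alpha+f+g,
  a homomorphism  Fm alpha f g : FG (alpha+f+g) -> FG alpha,  functorially:
  identities go to identities and the composite (f1+f2, g2+g1) of (f1,g1) and (f2,g2)
  goes to the composite of the homomorphisms in reverse order.\<close>

definition contra_natural_system ::
  "nat \<Rightarrow> ((nat \<Rightarrow> nat) \<Rightarrow> 'a monoid)
       \<Rightarrow> ((nat \<Rightarrow> nat) \<Rightarrow> (nat \<Rightarrow> nat) \<Rightarrow> (nat \<Rightarrow> nat) \<Rightarrow> 'a \<Rightarrow> 'a) \<Rightarrow> bool" where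
  "contra_natural_system n FG Fm \<longleftrightarrow>
     (\<forall>\<alpha>\<in>NN n. comm_group (FG \<alpha>)) \<and>
     (\<forall>\<alpha>\<in>NN n. \<forall>f\<in>NN n. \<forall>g\<in>NN n. Fm \<alpha> f g \<in> hom (FG (\<alpha> + f + g)) (FG \<alpha>)) \<and>
     (\<forall>\<alpha>\<in>NN n. \<forall>x\<in>carrier (FG \<alpha>). Fm \<alpha> 0 0 x = x) \<and>
     (\<forall>\<alpha>\<in>NN n. \<forall>f1\<in>NN n. \<forall>g1\<in>NN n. \<forall>f2\<in>NN n. \<forall>g2\<in>NN n.
        \<forall>x\<in>carrier (FG (\<alpha> + f1 + g1 + f2 + g2)).
          Fm \<alpha> (f1 + f2) (g2 + g1) x = Fm \<alpha> f1 g1 (Fm (\<alpha> + f1 + g1) f2 g2 x))"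

definition face_sum ::
  "('c \<Rightarrow> ('a, 'm) monoid_scheme) \<Rightarrow> 'c set \<Rightarrow> 'c set \<Rightarrow> 'j set \<Rightarrow> ('j \<Rightarrow> 'c \<Rightarrow> 'c)
     \<Rightarrow> ('j \<Rightarrow> 'c \<Rightarrow> 'a \<Rightarrow> 'a) \<Rightarrow> ('j \<Rightarrow> int) \<Rightarrow> ('c \<Rightarrow> 'a) \<Rightarrow> ('c \<Rightarrow> 'a)" where
  "face_sum G I I' J face coef sg x =
     (\<lambda>c'\<in>I'. finprod (G c') (\<lambda>(c, j). coef j c (x c) [^]\<^bsub>G c'\<^esub> sg j)
                 {(c, j). c \<in> I \<and> x c \<noteq> \<one>\<^bsub>G c\<^esub> \<and> j \<in> J \<and> face j c = c'})"

definition chain_homology ::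
  "(nat \<Rightarrow> ('a, 'm) monoid_scheme) \<Rightarrow> (nat \<Rightarrow> 'a \<Rightarrow> 'a) \<Rightarrow> nat \<Rightarrow> 'a set monoid" where
  "chain_homology C d k =
     subgroup_generated (C k)
        (if k = 0 then carrier (C 0) else kernel (C k) (C (k - 1)) (d k))
     Mod (d (Suc k) ` carrier (C (Suc k)))"

section \<open>Leech homology via the standard complex computing colim_k over (F N^n)^op\<close>

text \<open>A k-chain c_0 -> c_1 -> ... -> c_k in (F N^n)^op is encoded as (c_k, ms) where
  ms = [(f_0,g_0),...,(f_{k-1},g_{k-1})] and (f_j,g_j) : c_{j+1} -> c_j is a morphism of
  F N^n, so c_j = c_{j+1} + f_j + g_j.\<close>

type_synonym lchain = "(nat \<Rightarrow> nat) \<times> ((nat \<Rightarrow> nat) \<times> (nat \<Rightarrow> nat)) list"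

definition leech_chains :: "nat \<Rightarrow> nat \<Rightarrow> lchain set" where
  "leech_chains n k = {(c, ms). c \<in> NN n \<and> length ms = k \<and>
                         (\<forall>fg\<in>set ms. fst fg \<in> NN n \<and> snd fg \<in> NN n)}"

definition lobj :: "lchain \<Rightarrow> nat \<Rightarrow> nat \<Rightarrow> nat" where
  "lobj ch j = fst ch + (\<Sum>i\<in>{j..<length (snd ch)}. fst (snd ch ! i) + snd (snd ch ! i))"

text \<open>The i-th face of a k-chain (0 <= i <= k): drop c_0, compose at c_i, or drop c_k.\<close>
definition leech_face :: "nat \<Rightarrow> nat \<Rightarrow> lchain \<Rightarrow> lchain" where
  "leech_face k i ch =
     (if i = 0 then (fst ch, tl (snd ch))
      else if i < k then
        (fst ch, take (i - 1) (snd ch)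
                 @ [(fst (snd ch ! (i - 1)) + fst (snd ch ! i),
                     snd (snd ch ! (i - 1)) + snd (snd ch ! i))]
                 @ drop (Suc i) (snd ch))
      else (lobj ch (k - 1), butlast (snd ch)))"

definition leech_coef ::
  "((nat \<Rightarrow> nat) \<Rightarrow> (nat \<Rightarrow> nat) \<Rightarrow> (nat \<Rightarrow> nat) \<Rightarrow> 'a \<Rightarrow> 'a) \<Rightarrow> nat \<Rightarrow> lchain \<Rightarrow> 'a \<Rightarrow> 'a" where
  "leech_coef Fm i ch =
     (if i = 0 then Fm (lobj ch 1) (fst (snd ch ! 0)) (snd (snd ch ! 0)) else (\<lambda>x. x))"

definition leech_complex ::
  "nat \<Rightarrow> ((nat \<Rightarrow> nat) \<Rightarrow> 'a monoid) \<Rightarrow> nat \<Rightarrow> (lchain \<Rightarrow> 'a) monoid" where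
  "leech_complex n FG k = sum_group (leech_chains n k) (\<lambda>ch. FG (lobj ch 0))"

definition leech_diff ::
  "nat \<Rightarrow> ((nat \<Rightarrow> nat) \<Rightarrow> 'a monoid)
     \<Rightarrow> ((nat \<Rightarrow> nat) \<Rightarrow> (nat \<Rightarrow> nat) \<Rightarrow> (nat \<Rightarrow> nat) \<Rightarrow> 'a \<Rightarrow> 'a)
     \<Rightarrow> nat \<Rightarrow> (lchain \<Rightarrow> 'a) \<Rightarrow> (lchain \<Rightarrow> 'a)" where
  "leech_diff n FG Fm k =
     face_sum (\<lambda>ch. FG (lobj ch 0)) (leech_chains n k) (leech_chains n (k - 1)) {0..k}
              (leech_face k) (leech_coef Fm) (\<lambda>i. (-1) ^ i)"

definition leech_homology ::
  "nat \<Rightarrow> ((nat \<Rightarrow> nat) \<Rightarrow> 'a monoid)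
     \<Rightarrow> ((nat \<Rightarrow> nat) \<Rightarrow> (nat \<Rightarrow> nat) \<Rightarrow> (nat \<Rightarrow> nat) \<Rightarrow> 'a \<Rightarrow> 'a) \<Rightarrow> nat
     \<Rightarrow> (lchain \<Rightarrow> 'a) set monoid" where
  "leech_homology n FG Fm k = chain_homology (leech_complex n FG) (leech_diff n FG Fm) k"

text \<open>T^n_k: the words a_{i1}...a_{ik} with 1 <= i1 < ... < ik <= n, encoded as the sets
  {i1,...,ik}.\<close>
definition Tn :: "nat \<Rightarrow> nat \<Rightarrow> nat set set" where
  "Tn n k = {S. S \<subseteq> {1..n} \<and> card S = k}"

definition cube_idx :: "nat set \<Rightarrow> nat \<Rightarrow> nat" where
  "cube_idx S s = sorted_list_of_set S ! (s - 1)"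

text \<open>The face partial_s^{k,eps} (equal for eps = 0,1): delete a_{i_s}.\<close>
definition cube_face :: "nat \<times> bool \<Rightarrow> nat set \<Rightarrow> nat set" where
  "cube_face se S = S - {cube_idx S (fst se)}"

text \<open>F-bar of the face morphism: F(a_{i_s},1) for eps = 0 and F(1,a_{i_s}) for eps = 1,
  both maps F(a_{i1}..a_{ik}) -> F(a_{i1}..^a_{is}..a_{ik}).\<close>
definition cube_coef ::
  "((nat \<Rightarrow> nat) \<Rightarrow> (nat \<Rightarrow> nat) \<Rightarrow> (nat \<Rightarrow> nat) \<Rightarrow> 'a \<Rightarrow> 'a) \<Rightarrow> nat \<times> bool \<Rightarrow> nat set \<Rightarrow> 'a \<Rightarrow> 'a" where
  "cube_coef Fm se S =
     (let i = cube_idx S (fst se) in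
      if snd se then Fm (ind (S - {i})) 0 (gen i) else Fm (ind (S - {i})) (gen i) 0)"

text \<open>d_k = sum_{s=1}^k (-1)^s (d_s^{k,1} - d_s^{k,0}).\<close>
definition cube_sign :: "nat \<times> bool \<Rightarrow> int" where
  "cube_sign se = (if snd se then (-1) ^ fst se else - ((-1) ^ fst se))"

definition cube_complex ::
  "nat \<Rightarrow> ((nat \<Rightarrow> nat) \<Rightarrow> 'a monoid) \<Rightarrow> nat \<Rightarrow> (nat set \<Rightarrow> 'a) monoid" where
  "cube_complex n FG k = sum_group (Tn n k) (\<lambda>S. FG (ind S))"

definition cube_diff ::
  "nat \<Rightarrow> ((nat \<Rightarrow> nat) \<Rightarrow> 'a monoid)
     \<Rightarrow> ((nat \<Rightarrow> nat) \<Rightarrow> (nat \<Rightarrow> nat) \<Rightarrow> (nat \<Rightarrow> nat) \<Rightarrow> 'a \<Rightarrow> 'a)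
     \<Rightarrow> nat \<Rightarrow> (nat set \<Rightarrow> 'a) \<Rightarrow> (nat set \<Rightarrow> 'a)" where
  "cube_diff n FG Fm k =
     face_sum (\<lambda>S. FG (ind S)) (Tn n k) (Tn n (k - 1)) ({1..k} \<times> UNIV)
              cube_face (cube_coef Fm) cube_sign"

definition cube_homology ::
  "nat \<Rightarrow> ((nat \<Rightarrow> nat) \<Rightarrow> 'a monoid)
     \<Rightarrow> ((nat \<Rightarrow> nat) \<Rightarrow> (nat \<Rightarrow> nat) \<Rightarrow> (nat \<Rightarrow> nat) \<Rightarrow> 'a \<Rightarrow> 'a) \<Rightarrow> nat
     \<Rightarrow> (nat set \<Rightarrow> 'a) set monoid" where
  "cube_homology n FG Fm k = chain_homology (cube_complex n FG) (cube_diff n FG Fm) k"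

end

theory Submission
  imports Defs "HOL-Algebra.Free_Abelian_Groups"
begin

text \<open>Both complexes arise by tensoring \<open>F\<close> with a complex of free covariant functors on the factorization
  category of \<open>\<nat>\<^sup>n\<close>. A basis element \<open>b\<close> placed at the object \<open>ob b\<close> contributes at \<open>\<beta>\<close> the cells \<open>(b, f, g)\<close>
  with \<open>ob b + f + g = \<beta>\<close>. At each \<open>\<beta>\<close> the standard complex is the nerve of the category of factorizations
  of \<open>\<beta>\<close>, which has a terminal object, and the cubical complex consists of the cellular chains of the grid of
  unit cubes in the box with corners \<open>0\<close> and \<open>\<beta>\<close>. Both are therefore acyclic, and the method of acyclic models
  gives chain maps of free functors in both directions with homotopies to the identities. These survive
  tensoring with \<open>F\<close>.\<close>

section \<open>Free functors on the factorization category\<close>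

text \<open>As simplification rules these would turn sums of exponent functions into lambda terms.\<close>

declare plus_fun_apply [simp del] zero_fun_apply [simp del]

text \<open>The contractions behind acyclicity, \<open>leech_cone\<close> and
  \<open>cube_sweep\<close>, work over one object \<beta> at a time and do not commute with
  \<open>shift\<close>: a cone absorbs the factorization into its chain, and a sweep runs along the
  whole length of an exponent. They therefore induce nothing on the complexes tensored with
  \<open>F\<close>, and exactness alone need not survive tensoring. The way out is to use exactness
  only for choosing values on basis elements: an equation \<open>nat_ext d' w = z\<close> is solved
  over \<open>ob b\<close>, once for each \<open>b\<close>, and the solution is spread to all other
  objects by naturality. Chain maps and homotopies are accordingly stored as functions on basis
  elements, with values in the chains over the object of that element. Such values can be applied to
  coefficients directly, because tensoring \<open>F\<close> with the functor freely generated at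
  \<open>ob b\<close> returns \<open>FG (ob b)\<close>.\<close>

type_synonym 'b cell = "'b \<times> (nat \<Rightarrow> nat) \<times> (nat \<Rightarrow> nat)"

definition cells :: "nat \<Rightarrow> 'b set \<Rightarrow> ('b \<Rightarrow> nat \<Rightarrow> nat) \<Rightarrow> (nat \<Rightarrow> nat) \<Rightarrow> 'b cell set" where
  "cells n B ob \<beta> = {(b, f, g). b \<in> B \<and> f \<in> NN n \<and> g \<in> NN n \<and> ob b + f + g = \<beta>}"

text \<open>The action of the morphism \<open>(f, g)\<close> on a free functor. Composing morphisms
  adds exponents in each component; the order is immaterial because the monoid is
  commutative.\<close>

definition shift :: "(nat \<Rightarrow> nat) \<Rightarrow> (nat \<Rightarrow> nat) \<Rightarrow> ('b cell \<Rightarrow>\<^sub>0 int) \<Rightarrow> ('b cell \<Rightarrow>\<^sub>0 int)" where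
  "shift f g = frag_extend (\<lambda>(b, f', g'). frag_of (b, f + f', g + g'))"

text \<open>Yoneda: a natural transformation out of a free functor may be prescribed arbitrarily on
  the identity cells \<open>(b, 0, 0)\<close> and is determined by these values, which are the
  chains \<open>u b\<close>.\<close>

definition nat_ext :: "('b \<Rightarrow> ('c cell \<Rightarrow>\<^sub>0 int)) \<Rightarrow> ('b cell \<Rightarrow>\<^sub>0 int) \<Rightarrow> ('c cell \<Rightarrow>\<^sub>0 int)" where
  "nat_ext u = frag_extend (\<lambda>(b, f, g). shift f g (u b))"

lemma NN_0 [simp]: "0 \<in> NN n"
  by (simp add: NN_def zero_fun_apply)

lemma NN_add [simp]: "f \<in> NN n \<Longrightarrow> g \<in> NN n \<Longrightarrow> f + g \<in> NN n"
  by (simp add: NN_def plus_fun_apply)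

lemma frag_extend_frag_extend:
  "frag_extend F (frag_extend G z) = frag_extend (\<lambda>x. frag_extend F (G x)) z"
  using subset_UNIV
  by (induction z rule: frag_induction) (auto simp: frag_extend_diff)

lemma shift_of [simp]: "shift f g (frag_of (b, f', g')) = frag_of (b, f + f', g + g')"
  by (simp add: shift_def)

lemma shift_diff: "shift f g (x - y) = shift f g x - shift f g y"
  by (simp add: shift_def frag_extend_diff)

lemma shift_zero [simp]: "shift f g 0 = 0"
  by (simp add: shift_def)

lemma shift_cmul: "shift f g (frag_cmul c x) = frag_cmul c (shift f g x)"
  by (simp add: shift_def frag_extend_cmul)

lemma shift_sum: "finite I \<Longrightarrow> shift f g (\<Sum>i\<in>I. z i) = (\<Sum>i\<in>I. shift f g (z i))"
  by (simp add: shift_def frag_extend_sum o_def)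

lemma shift_shift: "shift f g (shift f' g' z) = shift (f + f') (g + g') z"
  unfolding shift_def frag_extend_frag_extend
  by (rule frag_extend_eq) (auto simp: add.assoc)

lemma shift_00 [simp]: "shift 0 0 z = z"
proof -
  have "shift 0 0 z = frag_extend frag_of z"
    unfolding shift_def by (rule frag_extend_eq) auto
  then show ?thesis
    using frag_expansion [of z] by simp
qed

lemma nat_ext_of [simp]: "nat_ext u (frag_of (b, f, g)) = shift f g (u b)"
  by (simp add: nat_ext_def)

lemma nat_ext_diff: "nat_ext u (x - y) = nat_ext u x - nat_ext u y"
  by (simp add: nat_ext_def frag_extend_diff)

lemma nat_ext_add: "nat_ext u (x + y) = nat_ext u x + nat_ext u y"
  by (simp add: nat_ext_def frag_extend_add)

lemma nat_ext_zero [simp]: "nat_ext u 0 = 0"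
  by (simp add: nat_ext_def)

lemma nat_ext_cmul: "nat_ext u (frag_cmul c x) = frag_cmul c (nat_ext u x)"
  by (simp add: nat_ext_def frag_extend_cmul)

lemma nat_ext_sum: "finite I \<Longrightarrow> nat_ext u (\<Sum>i\<in>I. z i) = (\<Sum>i\<in>I. nat_ext u (z i))"
  by (simp add: nat_ext_def frag_extend_sum o_def)

text \<open>Naturality: on a cell both sides translate \<open>u b\<close> by the composite of the
  two factorizations.\<close>

lemma nat_ext_shift: "nat_ext u (shift f g z) = shift f g (nat_ext u z)"
proof -
  have "frag_extend (\<lambda>(b, f, g). shift f g (u b)) (frag_extend (\<lambda>(b, f', g'). frag_of (b, f + f', g + g')) z)
      = frag_extend (\<lambda>x. shift f g ((\<lambda>(b, f, g). shift f g (u b)) x)) z"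
    unfolding frag_extend_frag_extend
    by (rule frag_extend_eq) (auto simp: shift_shift)
  then show ?thesis
    unfolding nat_ext_def shift_def frag_extend_frag_extend .
qed

lemma nat_ext_cong:
  assumes "Poly_Mapping.keys z \<subseteq> cells n B ob \<beta>" "\<And>b. b \<in> B \<Longrightarrow> u b = v b"
  shows "nat_ext u z = nat_ext v z"
  unfolding nat_ext_def using assms
  by (intro frag_extend_eq) (auto simp: cells_def)

text \<open>Composites of natural transformations are again given by values on basis elements, so
  equations such as \<open>d d = 0\<close> have to be checked there only.\<close>

lemma nat_ext_nat_ext: "nat_ext v (nat_ext u z) = nat_ext (\<lambda>b. nat_ext v (u b)) z"
proof -
  have "nat_ext v (nat_ext u z) = frag_extend (\<lambda>x. nat_ext v ((\<lambda>(b, f, g). shift f g (u b)) x)) z"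
    unfolding nat_ext_def frag_extend_frag_extend ..
  also have "\<dots> = nat_ext (\<lambda>b. nat_ext v (u b)) z"
    unfolding nat_ext_def [of "\<lambda>b. nat_ext v (u b)"]
    by (rule frag_extend_eq) (auto simp: nat_ext_shift)
  finally show ?thesis .
qed

lemma nat_ext_id [simp]: "nat_ext (\<lambda>b. frag_of (b, 0, 0)) z = z"
proof -
  have "nat_ext (\<lambda>b. frag_of (b, 0, 0)) z = frag_extend frag_of z"
    unfolding nat_ext_def by (rule frag_extend_eq) auto
  then show ?thesis
    using frag_expansion [of z] by simp
qed

lemma nat_ext_fun_diff: "nat_ext (\<lambda>b. u b - v b) z = nat_ext u z - nat_ext v z"
  using subset_UNIV
proof (induction z rule: frag_induction)
  case (one x)
  then show ?case
    by (cases x) (simp add: shift_diff)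
qed (auto simp: nat_ext_diff algebra_simps)

lemma cells_shift:
  assumes "x \<in> cells n B ob \<beta>" "f \<in> NN n" "g \<in> NN n"
  shows "(fst x, f + fst (snd x), g + snd (snd x)) \<in> cells n B ob (\<beta> + f + g)"
  using assms by (auto simp: cells_def algebra_simps)

lemma keys_shift:
  assumes "Poly_Mapping.keys z \<subseteq> cells n B ob \<beta>" "f \<in> NN n" "g \<in> NN n"
  shows "Poly_Mapping.keys (shift f g z) \<subseteq> cells n B ob (\<beta> + f + g)"
proof -
  have "Poly_Mapping.keys (shift f g z)
      \<subseteq> (\<Union>x \<in> Poly_Mapping.keys z. Poly_Mapping.keys ((\<lambda>(b, f', g'). frag_of (b, f + f', g + g')) x))"
    unfolding shift_def by (rule keys_frag_extend)
  also have "\<dots> \<subseteq> cells n B ob (\<beta> + f + g)"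
    using assms cells_shift by fastforce
  finally show ?thesis .
qed

lemma keys_nat_ext:
  assumes "Poly_Mapping.keys z \<subseteq> cells n B ob \<beta>"
    and "\<And>b. b \<in> B \<Longrightarrow> Poly_Mapping.keys (u b) \<subseteq> cells n B' ob' (ob b)"
  shows "Poly_Mapping.keys (nat_ext u z) \<subseteq> cells n B' ob' \<beta>"
proof -
  have "Poly_Mapping.keys (nat_ext u z)
      \<subseteq> (\<Union>x \<in> Poly_Mapping.keys z. Poly_Mapping.keys ((\<lambda>(b, f, g). shift f g (u b)) x))"
    unfolding nat_ext_def by (rule keys_frag_extend)
  also have "\<dots> \<subseteq> cells n B' ob' \<beta>"
  proof (rule UN_least)
    fix x assume "x \<in> Poly_Mapping.keys z"
    then have x: "x \<in> cells n B ob \<beta>"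
      using assms(1) by blast
    then show "Poly_Mapping.keys ((\<lambda>(b, f, g). shift f g (u b)) x) \<subseteq> cells n B' ob' \<beta>"
      using keys_shift [OF assms(2) [of "fst x"], of "fst (snd x)" "snd (snd x)"]
      by (auto simp: cells_def)
  qed
  finally show ?thesis .
qed

section \<open>Comparison of acyclic free complexes\<close>

text \<open>Exactness of the augmented complex is expressed without the augmentation: boundaries of generators in
  degree 1 are differences of two vertices, and any two vertices over the same object differ by a boundary.\<close>

locale acyclic_complex =
  fixes n :: nat and B :: "nat \<Rightarrow> 'b set" and ob :: "'b \<Rightarrow> nat \<Rightarrow> nat"
    and d :: "'b \<Rightarrow> ('b cell \<Rightarrow>\<^sub>0 int)"
  assumes ob_in: "b \<in> B k \<Longrightarrow> ob b \<in> NN n"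
    and keys_d: "b \<in> B (Suc k) \<Longrightarrow> Poly_Mapping.keys (d b) \<subseteq> cells n (B k) ob (ob b)"
    and d_d: "b \<in> B (Suc (Suc k)) \<Longrightarrow> nat_ext d (d b) = 0"
    and d_1: "b \<in> B 1 \<Longrightarrow> \<exists>x \<in> cells n (B 0) ob (ob b). \<exists>y \<in> cells n (B 0) ob (ob b).
                  d b = frag_of x - frag_of y"
    and cells_0_nonempty: "\<beta> \<in> NN n \<Longrightarrow> cells n (B 0) ob \<beta> \<noteq> {}"
    and exact_0: "\<lbrakk>\<beta> \<in> NN n; x \<in> cells n (B 0) ob \<beta>; y \<in> cells n (B 0) ob \<beta>\<rbrakk> \<Longrightarrow>
        \<exists>w. Poly_Mapping.keys w \<subseteq> cells n (B 1) ob \<beta> \<and> nat_ext d w = frag_of x - frag_of y"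
    and exact_Suc: "\<lbrakk>\<beta> \<in> NN n; Poly_Mapping.keys z \<subseteq> cells n (B (Suc k)) ob \<beta>; nat_ext d z = 0\<rbrakk> \<Longrightarrow>
        \<exists>w. Poly_Mapping.keys w \<subseteq> cells n (B (Suc (Suc k))) ob \<beta> \<and> nat_ext d w = z"

text \<open>Carried along in the invariants of the two recursions below: a choice in degree
  \<open>k\<close> has to guarantee that the equation for the next degree can be solved.\<close>

definition liftable where
  "liftable n B ob d k \<beta> z \<longleftrightarrow>
    (\<exists>w. Poly_Mapping.keys w \<subseteq> cells n (B (Suc k)) ob \<beta> \<and> nat_ext d w = z)"

text \<open>Sending a basis element of degree 0 to a single vertex, with coefficient 1, replaces
  compatibility with the augmentations.\<close>

definition chain_map where
  "chain_map n B ob d B' ob' d' \<phi> \<longleftrightarrow>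
    (\<forall>b \<in> B 0. \<exists>x \<in> cells n (B' 0) ob' (ob b). \<phi> 0 b = frag_of x) \<and>
    (\<forall>k. \<forall>b \<in> B k. Poly_Mapping.keys (\<phi> k b) \<subseteq> cells n (B' k) ob' (ob b)) \<and>
    (\<forall>k. \<forall>b \<in> B (Suc k). nat_ext d' (\<phi> (Suc k) b) = nat_ext (\<phi> k) (d b))"

lemma chain_mapD:
  assumes "chain_map n B ob d B' ob' d' \<phi>"
  shows "b \<in> B 0 \<Longrightarrow> \<exists>x \<in> cells n (B' 0) ob' (ob b). \<phi> 0 b = frag_of x"
    and "b \<in> B k \<Longrightarrow> Poly_Mapping.keys (\<phi> k b) \<subseteq> cells n (B' k) ob' (ob b)"
    and "b \<in> B (Suc k) \<Longrightarrow> nat_ext d' (\<phi> (Suc k) b) = nat_ext (\<phi> k) (d b)"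
  using assms unfolding chain_map_def by blast+

text \<open>The degree 0 clause stands apart because the boundary of a basis element is meaningful
  in positive degrees only.\<close>

definition homotopy_to_id where
  "homotopy_to_id n B ob d \<chi> s \<longleftrightarrow>
    (\<forall>k. \<forall>b \<in> B k. Poly_Mapping.keys (s k b) \<subseteq> cells n (B (Suc k)) ob (ob b)) \<and>
    (\<forall>b \<in> B 0. \<chi> 0 b = frag_of (b, 0, 0) + nat_ext d (s 0 b)) \<and>
    (\<forall>k. \<forall>b \<in> B (Suc k).
      \<chi> (Suc k) b = frag_of (b, 0, 0) + nat_ext d (s (Suc k) b) + nat_ext (s k) (d b))"

lemma homotopy_to_idD:
  assumes "homotopy_to_id n B ob d \<chi> s"
  shows "b \<in> B k \<Longrightarrow> Poly_Mapping.keys (s k b) \<subseteq> cells n (B (Suc k)) ob (ob b)"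
    and "b \<in> B 0 \<Longrightarrow> \<chi> 0 b = frag_of (b, 0, 0) + nat_ext d (s 0 b)"
    and "b \<in> B (Suc k) \<Longrightarrow>
      \<chi> (Suc k) b = frag_of (b, 0, 0) + nat_ext d (s (Suc k) b) + nat_ext (s k) (d b)"
  using assms unfolding homotopy_to_id_def by blast+

text \<open>The image of a basis element is chosen as a filling of the image of its boundary, which
  is a cycle over \<open>ob b\<close>; acyclicity of the target provides the filling.\<close>

lemma chain_map_exists:
  assumes P: "acyclic_complex n B ob d" and Q: "acyclic_complex n B' ob' d'"
  obtains \<phi> where "chain_map n B ob d B' ob' d' \<phi>"
proof -
  interpret P: acyclic_complex n B ob d by fact
  interpret Q: acyclic_complex n B' ob' d' by fact
  define R where "R k \<phi> \<longleftrightarrow>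
      (\<forall>b \<in> B k. Poly_Mapping.keys (\<phi> b) \<subseteq> cells n (B' k) ob' (ob b)) \<and>
      (k = 0 \<longrightarrow> (\<forall>b \<in> B 0. \<exists>x \<in> cells n (B' 0) ob' (ob b). \<phi> b = frag_of x)) \<and>
      (\<forall>b \<in> B (Suc k). liftable n B' ob' d' k (ob b) (nat_ext \<phi> (d b)))" for k \<phi>
  have "\<exists>\<phi>. \<forall>k. R k (\<phi> k) \<and> (\<forall>b \<in> B (Suc k). nat_ext d' (\<phi> (Suc k) b) = nat_ext (\<phi> k) (d b))"
  proof (rule dependent_nat_choice)
    \<comment> \<open>Any vertex over \<open>ob b\<close> will do: two choices differ by a boundary,
      by \<open>exact_0\<close>.\<close>
    have "\<forall>b. \<exists>x. b \<in> B 0 \<longrightarrow> x \<in> cells n (B' 0) ob' (ob b)"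
      using Q.cells_0_nonempty P.ob_in by blast
    then obtain x where x: "\<And>b. b \<in> B 0 \<Longrightarrow> x b \<in> cells n (B' 0) ob' (ob b)"
      by metis
    define \<phi> where "\<phi> b = frag_of (x b)" for b
    have "liftable n B' ob' d' 0 (ob b) (nat_ext \<phi> (d b))" if b: "b \<in> B (Suc 0)" for b
    proof -
      \<comment> \<open>The image of a vertex is a translate of a chosen vertex, hence a single
        vertex again. So the boundary of an edge goes to a difference of two vertices, as
        \<open>exact_0\<close> requires.\<close>
      have shifted: "\<exists>y \<in> cells n (B' 0) ob' (ob b). nat_ext \<phi> (frag_of c) = frag_of y"
        if c: "c \<in> cells n (B 0) ob (ob b)" for c
      proof -
        obtain b' f g where c_eq: "c = (b', f, g)" "b' \<in> B 0" "f \<in> NN n" "g \<in> NN n" "ob b' + f + g = ob b"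
          using c by (auto simp: cells_def)
        show ?thesis
          using cells_shift [OF x [OF c_eq(2)] c_eq(3,4)] c_eq
          by (cases "x b'") (auto simp: \<phi>_def)
      qed
      obtain c c' where "c \<in> cells n (B 0) ob (ob b)" "c' \<in> cells n (B 0) ob (ob b)"
          "d b = frag_of c - frag_of c'"
        using P.d_1 [of b] b by (metis One_nat_def)
      then show ?thesis
        using shifted [of c] shifted [of c'] Q.exact_0 P.ob_in [OF b]
        by (auto simp: liftable_def nat_ext_diff)
    qed
    then have "R 0 \<phi>"
      using x by (auto simp: R_def \<phi>_def)
    then show "\<exists>\<phi>. R 0 \<phi>" by blast
  next
    fix \<phi> k assume R: "R k \<phi>"
    then have "\<forall>b. \<exists>w. b \<in> B (Suc k) \<longrightarrow>
        Poly_Mapping.keys w \<subseteq> cells n (B' (Suc k)) ob' (ob b) \<and> nat_ext d' w = nat_ext \<phi> (d b)"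
      unfolding R_def liftable_def by blast
    then obtain \<psi> where \<psi>: "\<And>b. b \<in> B (Suc k) \<Longrightarrow> Poly_Mapping.keys (\<psi> b) \<subseteq> cells n (B' (Suc k)) ob' (ob b)"
        "\<And>b. b \<in> B (Suc k) \<Longrightarrow> nat_ext d' (\<psi> b) = nat_ext \<phi> (d b)"
      by metis
    have "liftable n B' ob' d' (Suc k) (ob b) (nat_ext \<psi> (d b))" if b: "b \<in> B (Suc (Suc k))" for b
    proof -
      \<comment> \<open>The chain to be filled in the next degree is a cycle:
        \<open>d' \<psi> d = \<phi> d d = 0\<close>.\<close>
      have "nat_ext d' (nat_ext \<psi> (d b)) = nat_ext (\<lambda>c. nat_ext d' (\<psi> c)) (d b)"
        by (rule nat_ext_nat_ext)
      also have "\<dots> = nat_ext (\<lambda>c. nat_ext \<phi> (d c)) (d b)"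
        using P.keys_d [OF b] \<psi>(2) by (rule nat_ext_cong)
      also have "\<dots> = nat_ext \<phi> (nat_ext d (d b))"
        by (simp add: nat_ext_nat_ext)
      finally have "nat_ext d' (nat_ext \<psi> (d b)) = 0"
        by (simp add: P.d_d [OF b])
      then show ?thesis
        unfolding liftable_def
        using Q.exact_Suc P.ob_in [OF b] keys_nat_ext [OF P.keys_d [OF b] \<psi>(1)] by blast
    qed
    then have "R (Suc k) \<psi>"
      using \<psi>(1) by (auto simp: R_def)
    then show "\<exists>\<psi>. R (Suc k) \<psi> \<and> (\<forall>b \<in> B (Suc k). nat_ext d' (\<psi> b) = nat_ext \<phi> (d b))"
      using \<psi>(2) by blast
  qed
  then obtain \<phi> where R: "\<And>k. R k (\<phi> k)" and step: "\<And>k b. b \<in> B (Suc k) \<Longrightarrow> nat_ext d' (\<phi> (Suc k) b) = nat_ext (\<phi> k) (d b)"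
    by blast
  show thesis
    by (rule that [of \<phi>]) (use R step in \<open>auto simp: R_def chain_map_def\<close>)
qed

text \<open>A chain map that has augmentation zero in degree 0 is null-homotopic:
  \<open>\<theta> - s d\<close> is a cycle in each degree and is filled basis element by basis
  element.\<close>

lemma null_homotopy_exists:
  assumes P: "acyclic_complex n B ob d" and Q: "acyclic_complex n B' ob' d'"
    and keys_\<theta>: "\<And>k b. b \<in> B k \<Longrightarrow> Poly_Mapping.keys (\<theta> k b) \<subseteq> cells n (B' k) ob' (ob b)"
    and \<theta>_0: "\<And>b. b \<in> B 0 \<Longrightarrow> \<exists>x \<in> cells n (B' 0) ob' (ob b). \<exists>y \<in> cells n (B' 0) ob' (ob b).
                  \<theta> 0 b = frag_of x - frag_of y"
    and \<theta>_Suc: "\<And>k b. b \<in> B (Suc k) \<Longrightarrow> nat_ext d' (\<theta> (Suc k) b) = nat_ext (\<theta> k) (d b)"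
  obtains s where
    "\<And>k b. b \<in> B k \<Longrightarrow> Poly_Mapping.keys (s k b) \<subseteq> cells n (B' (Suc k)) ob' (ob b)"
    "\<And>b. b \<in> B 0 \<Longrightarrow> nat_ext d' (s 0 b) = \<theta> 0 b"
    "\<And>k b. b \<in> B (Suc k) \<Longrightarrow> nat_ext d' (s (Suc k) b) = \<theta> (Suc k) b - nat_ext (s k) (d b)"
proof -
  interpret P: acyclic_complex n B ob d by fact
  interpret Q: acyclic_complex n B' ob' d' by fact
  define R where "R k s \<longleftrightarrow>
      (\<forall>b \<in> B k. Poly_Mapping.keys (s b) \<subseteq> cells n (B' (Suc k)) ob' (ob b)) \<and>
      (k = 0 \<longrightarrow> (\<forall>b \<in> B 0. nat_ext d' (s b) = \<theta> 0 b)) \<and>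
      (\<forall>b \<in> B (Suc k). liftable n B' ob' d' (Suc k) (ob b) (\<theta> (Suc k) b - nat_ext s (d b)))" for k s
  \<comment> \<open>The premise \<open>eq\<close> says that \<open>d' s\<close> and
    \<open>\<theta>\<close> agree on the boundary of \<open>b\<close>; this makes
    \<open>\<theta> b - s (d b)\<close> a cycle. In the lowest degree it comes from
    \<open>d' s = \<theta>\<close>, later from the previous equation for \<open>s\<close>.\<close>
  have lift: "liftable n B' ob' d' (Suc k) (ob b) (\<theta> (Suc k) b - nat_ext s (d b))"
    if b: "b \<in> B (Suc k)" and s: "\<And>c. c \<in> B k \<Longrightarrow> Poly_Mapping.keys (s c) \<subseteq> cells n (B' (Suc k)) ob' (ob c)"
      and eq: "nat_ext (\<lambda>c. nat_ext d' (s c)) (d b) = nat_ext (\<theta> k) (d b)" for b k s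
  proof -
    have "nat_ext d' (\<theta> (Suc k) b - nat_ext s (d b)) = 0"
      by (simp add: nat_ext_diff nat_ext_nat_ext eq \<theta>_Suc [OF b])
    moreover have "Poly_Mapping.keys (\<theta> (Suc k) b - nat_ext s (d b)) \<subseteq> cells n (B' (Suc k)) ob' (ob b)"
      by (rule order_trans [OF keys_diff])
        (intro Un_least keys_\<theta> [OF b] keys_nat_ext [OF P.keys_d [OF b] s])
    ultimately show ?thesis
      unfolding liftable_def using Q.exact_Suc P.ob_in [OF b] by blast
  qed
  have "\<exists>s. \<forall>k. R k (s k) \<and> (\<forall>b \<in> B (Suc k). nat_ext d' (s (Suc k) b) = \<theta> (Suc k) b - nat_ext (s k) (d b))"
  proof (rule dependent_nat_choice)
    have "\<forall>b. \<exists>w. b \<in> B 0 \<longrightarrow> Poly_Mapping.keys w \<subseteq> cells n (B' 1) ob' (ob b) \<and> nat_ext d' w = \<theta> 0 b"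
    proof (intro allI)
      fix b
      show "\<exists>w. b \<in> B 0 \<longrightarrow> Poly_Mapping.keys w \<subseteq> cells n (B' 1) ob' (ob b) \<and> nat_ext d' w = \<theta> 0 b"
      proof (cases "b \<in> B 0")
        case True
        then obtain x y where "x \<in> cells n (B' 0) ob' (ob b)" "y \<in> cells n (B' 0) ob' (ob b)"
            "\<theta> 0 b = frag_of x - frag_of y"
          using \<theta>_0 by blast
        then show ?thesis
          using Q.exact_0 [OF P.ob_in [OF True]] by metis
      qed blast
    qed
    then obtain s where s: "\<And>b. b \<in> B 0 \<Longrightarrow> Poly_Mapping.keys (s b) \<subseteq> cells n (B' (Suc 0)) ob' (ob b)"
        "\<And>b. b \<in> B 0 \<Longrightarrow> nat_ext d' (s b) = \<theta> 0 b"
      by (metis One_nat_def)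
    have "liftable n B' ob' d' (Suc 0) (ob b) (\<theta> (Suc 0) b - nat_ext s (d b))" if b: "b \<in> B (Suc 0)" for b
      using b s(1) nat_ext_cong [OF P.keys_d [OF b] s(2)] by (rule lift)
    then have "R 0 s"
      using s by (auto simp: R_def)
    then show "\<exists>s. R 0 s" by blast
  next
    fix s k assume R: "R k s"
    then have "\<forall>b. \<exists>w. b \<in> B (Suc k) \<longrightarrow>
        Poly_Mapping.keys w \<subseteq> cells n (B' (Suc (Suc k))) ob' (ob b) \<and>
        nat_ext d' w = \<theta> (Suc k) b - nat_ext s (d b)"
      unfolding R_def liftable_def by blast
    then obtain t where t: "\<And>b. b \<in> B (Suc k) \<Longrightarrow> Poly_Mapping.keys (t b) \<subseteq> cells n (B' (Suc (Suc k))) ob' (ob b)"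
        "\<And>b. b \<in> B (Suc k) \<Longrightarrow> nat_ext d' (t b) = \<theta> (Suc k) b - nat_ext s (d b)"
      by metis
    have "liftable n B' ob' d' (Suc (Suc k)) (ob b) (\<theta> (Suc (Suc k)) b - nat_ext t (d b))"
      if b: "b \<in> B (Suc (Suc k))" for b
    proof -
      \<comment> \<open>The correction term is \<open>s\<close> applied to \<open>d (d b)\<close>
        and therefore disappears.\<close>
      have "nat_ext (\<lambda>c. nat_ext d' (t c)) (d b) = nat_ext (\<lambda>c. \<theta> (Suc k) c - nat_ext s (d c)) (d b)"
        using P.keys_d [OF b] t(2) by (rule nat_ext_cong)
      also have "\<dots> = nat_ext (\<theta> (Suc k)) (d b) - nat_ext s (nat_ext d (d b))"
        by (simp add: nat_ext_fun_diff nat_ext_nat_ext)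
      finally show ?thesis
        using lift [OF b t(1)] P.d_d [OF b] by simp
    qed
    then have "R (Suc k) t"
      using t(1) by (auto simp: R_def)
    then show "\<exists>t. R (Suc k) t \<and> (\<forall>b \<in> B (Suc k). nat_ext d' (t b) = \<theta> (Suc k) b - nat_ext s (d b))"
      using t(2) by blast
  qed
  then obtain s where R: "\<And>k. R k (s k)"
      and step: "\<And>k b. b \<in> B (Suc k) \<Longrightarrow> nat_ext d' (s (Suc k) b) = \<theta> (Suc k) b - nat_ext (s k) (d b)"
    by blast
  show thesis
  proof (rule that [of s])
    show "Poly_Mapping.keys (s k b) \<subseteq> cells n (B' (Suc k)) ob' (ob b)" if "b \<in> B k" for k b
      using R [of k] that unfolding R_def by blast
    show "nat_ext d' (s 0 b) = \<theta> 0 b" if "b \<in> B 0" for b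
      using R [of 0] that unfolding R_def by blast
  qed (fact step)
qed

text \<open>Apply the null homotopy to \<open>\<psi> \<phi> - id\<close>. In degree 0 both terms are
  single vertices over the same object, so the augmentation of the difference is zero.\<close>

lemma round_trip_homotopy_exists:
  assumes P: "acyclic_complex n B ob d"
    and chain_map_\<phi>: "chain_map n B ob d B' ob' d' \<phi>"
    and chain_map_\<psi>: "chain_map n B' ob' d' B ob d \<psi>"
  obtains s where "homotopy_to_id n B ob d (\<lambda>k b. nat_ext (\<psi> k) (\<phi> k b)) s"
proof -
  interpret P: acyclic_complex n B ob d by fact
  note \<phi> = chain_mapD [OF chain_map_\<phi>] and \<psi> = chain_mapD [OF chain_map_\<psi>]
  define \<theta> where "\<theta> k b = nat_ext (\<psi> k) (\<phi> k b) - frag_of (b, 0, 0)" for k b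
  have unit: "(b, 0, 0) \<in> cells n (B k) ob (ob b)" if "b \<in> B k" for b k
    using that by (simp add: cells_def)
  have 1: "Poly_Mapping.keys (\<theta> k b) \<subseteq> cells n (B k) ob (ob b)" if b: "b \<in> B k" for k b
    unfolding \<theta>_def using unit [OF b]
    by (intro order_trans [OF keys_diff] Un_least keys_nat_ext [OF \<phi>(2) [OF b] \<psi>(2)]) auto
  have 2: "\<exists>x \<in> cells n (B 0) ob (ob b). \<exists>y \<in> cells n (B 0) ob (ob b). \<theta> 0 b = frag_of x - frag_of y"
    if b: "b \<in> B 0" for b
  proof -
    obtain b' f g where c: "(b', f, g) \<in> cells n (B' 0) ob' (ob b)" "\<phi> 0 b = frag_of (b', f, g)"
      using \<phi>(1) [OF b] by (metis prod_cases3)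
    then have b': "b' \<in> B' 0"
      by (simp add: cells_def)
    obtain x where x: "x \<in> cells n (B 0) ob (ob' b')" "\<psi> 0 b' = frag_of x"
      using \<psi>(1) [OF b'] by blast
    have "\<theta> 0 b = frag_of (fst x, f + fst (snd x), g + snd (snd x)) - frag_of (b, 0, 0)"
      using c x by (cases x) (simp add: \<theta>_def)
    moreover have "(fst x, f + fst (snd x), g + snd (snd x)) \<in> cells n (B 0) ob (ob b)"
      using cells_shift [OF x(1), of f g] c(1) by (auto simp: cells_def)
    ultimately show ?thesis
      using unit [OF b] by blast
  qed
  have 3: "nat_ext d (\<theta> (Suc k) b) = nat_ext (\<theta> k) (d b)" if b: "b \<in> B (Suc k)" for k b
  proof -
    \<comment> \<open>The composite commutes with the boundaries because both factors do, and
      subtracting the identity preserves this.\<close>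
    have "nat_ext d (nat_ext (\<psi> (Suc k)) (\<phi> (Suc k) b)) = nat_ext (\<lambda>c. nat_ext (\<psi> k) (d' c)) (\<phi> (Suc k) b)"
      unfolding nat_ext_nat_ext using \<phi>(2) [OF b] \<psi>(3) by (rule nat_ext_cong)
    also have "\<dots> = nat_ext (\<psi> k) (nat_ext (\<phi> k) (d b))"
      by (simp add: nat_ext_nat_ext flip: \<phi>(3) [OF b])
    also have "\<dots> = nat_ext (\<theta> k) (d b) + d b"
      by (simp add: \<theta>_def [abs_def] nat_ext_fun_diff nat_ext_nat_ext)
    finally show ?thesis
      by (simp add: \<theta>_def nat_ext_diff)
  qed
  obtain s where s: "\<And>k b. b \<in> B k \<Longrightarrow> Poly_Mapping.keys (s k b) \<subseteq> cells n (B (Suc k)) ob (ob b)"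
    "\<And>b. b \<in> B 0 \<Longrightarrow> nat_ext d (s 0 b) = \<theta> 0 b"
    "\<And>k b. b \<in> B (Suc k) \<Longrightarrow> nat_ext d (s (Suc k) b) = \<theta> (Suc k) b - nat_ext (s k) (d b)"
    using null_homotopy_exists [OF P P 1 2 3] by blast
  show thesis
    by (rule that [of s]) (use s in \<open>auto simp: \<theta>_def homotopy_to_id_def\<close>)
qed

section \<open>Homomorphisms out of free abelian groups and direct sums\<close>

text \<open>The homomorphism out of a free abelian group with prescribed values on generators. The
  target is written multiplicatively, so integer coefficients appear as exponents.\<close>

definition frag_lin :: "('a, 'm) monoid_scheme \<Rightarrow> ('k \<Rightarrow> 'a) \<Rightarrow> ('k \<Rightarrow>\<^sub>0 int) \<Rightarrow> 'a" where
  "frag_lin G u z = finprod G (\<lambda>k. u k [^]\<^bsub>G\<^esub> Poly_Mapping.lookup z k) (Poly_Mapping.keys z)"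

context comm_group
begin

lemma frag_lin_superset:
  assumes "finite A" "Poly_Mapping.keys z \<subseteq> A" "u \<in> A \<rightarrow> carrier G"
  shows "frag_lin G u z = finprod G (\<lambda>k. u k [^] Poly_Mapping.lookup z k) A"
  unfolding frag_lin_def using assms
  by (intro finprod_mono_neutral_cong_left) (auto simp: in_keys_iff Pi_iff)

lemma frag_lin_closed:
  assumes "\<And>k. k \<in> Poly_Mapping.keys z \<Longrightarrow> u k \<in> carrier G"
  shows "frag_lin G u z \<in> carrier G"
  unfolding frag_lin_def using assms by (intro finprod_closed) auto

lemma frag_lin_cong:
  assumes "\<And>k. k \<in> Poly_Mapping.keys z \<Longrightarrow> u k = v k"
    and "\<And>k. k \<in> Poly_Mapping.keys z \<Longrightarrow> v k \<in> carrier G"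
  shows "frag_lin G u z = frag_lin G v z"
  unfolding frag_lin_def using assms by (intro finprod_cong') auto

lemma frag_lin_zero [simp]: "frag_lin G u 0 = \<one>"
  by (simp add: frag_lin_def)

lemma frag_lin_single:
  assumes "u k \<in> carrier G"
  shows "frag_lin G u (frag_cmul c (frag_of k)) = u k [^] c"
  using frag_lin_superset [of "{k}" "frag_cmul c (frag_of k)" u] assms keys_cmul [of c "frag_of k"] by auto

lemma frag_lin_of [simp]:
  assumes "u k \<in> carrier G"
  shows "frag_lin G u (frag_of k) = u k"
  using frag_lin_single [of u k 1] assms by simp

lemma frag_lin_add:
  assumes "u \<in> S \<rightarrow> carrier G" "Poly_Mapping.keys x \<subseteq> S" "Poly_Mapping.keys y \<subseteq> S"
  shows "frag_lin G u (x + y) = frag_lin G u x \<otimes> frag_lin G u y"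
proof -
  let ?A = "Poly_Mapping.keys x \<union> Poly_Mapping.keys y"
  have u: "u \<in> ?A \<rightarrow> carrier G"
    using assms by auto
  have "frag_lin G u (x + y) = finprod G (\<lambda>k. u k [^] Poly_Mapping.lookup (x + y) k) ?A"
    using u by (intro frag_lin_superset) (auto simp: keys_add)
  also have "\<dots> = finprod G (\<lambda>k. u k [^] Poly_Mapping.lookup x k \<otimes> u k [^] Poly_Mapping.lookup y k) ?A"
    using u by (intro finprod_cong') (auto simp: lookup_add int_pow_mult Pi_iff)
  also have "\<dots> = finprod G (\<lambda>k. u k [^] Poly_Mapping.lookup x k) ?A
      \<otimes> finprod G (\<lambda>k. u k [^] Poly_Mapping.lookup y k) ?A"
    using u by (intro finprod_multf) auto
  also have "\<dots> = frag_lin G u x \<otimes> frag_lin G u y"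
    using u by (simp add: frag_lin_superset [symmetric])
  finally show ?thesis .
qed

lemma frag_lin_hom: "u \<in> S \<rightarrow> carrier G \<Longrightarrow> frag_lin G u \<in> hom (free_Abelian_group S) G"
  by (rule homI) (auto intro: frag_lin_closed frag_lin_add)

lemma frag_lin_sum:
  assumes "finite J" "\<And>j. j \<in> J \<Longrightarrow> u (c j) \<in> carrier G"
  shows "frag_lin G u (\<Sum>j\<in>J. frag_cmul (s j) (frag_of (c j))) = finprod G (\<lambda>j. u (c j) [^] s j) J"
  using assms
proof (induction J rule: finite_induct)
  case (insert j J)
  have "frag_lin G u (frag_cmul (s j) (frag_of (c j)) + (\<Sum>j\<in>J. frag_cmul (s j) (frag_of (c j))))
      = frag_lin G u (frag_cmul (s j) (frag_of (c j))) \<otimes> frag_lin G u (\<Sum>j\<in>J. frag_cmul (s j) (frag_of (c j)))"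
  proof (rule frag_lin_add)
    show "u \<in> c ` insert j J \<rightarrow> carrier G"
      using insert.prems by auto
    show "Poly_Mapping.keys (frag_cmul (s j) (frag_of (c j))) \<subseteq> c ` insert j J"
      by auto
    show "Poly_Mapping.keys (\<Sum>j\<in>J. frag_cmul (s j) (frag_of (c j))) \<subseteq> c ` insert j J"
      by (rule order_trans [OF keys_sum]) auto
  qed
  with insert show ?case
    by (simp add: frag_lin_single Pi_iff)
qed simp

text \<open>Additivity in the values instead of the chain; it makes the evaluation of a fixed chain
  additive in the coefficient.\<close>

lemma frag_lin_mult:
  assumes "u \<in> Poly_Mapping.keys z \<rightarrow> carrier G" "v \<in> Poly_Mapping.keys z \<rightarrow> carrier G"
  shows "frag_lin G (\<lambda>k. u k \<otimes> v k) z = frag_lin G u z \<otimes> frag_lin G v z"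
proof -
  have "frag_lin G (\<lambda>k. u k \<otimes> v k) z
      = finprod G (\<lambda>k. u k [^] Poly_Mapping.lookup z k \<otimes> v k [^] Poly_Mapping.lookup z k) (Poly_Mapping.keys z)"
    unfolding frag_lin_def using assms
    by (intro finprod_cong') (auto simp: int_pow_distrib Pi_iff)
  also have "\<dots> = frag_lin G u z \<otimes> frag_lin G v z"
    unfolding frag_lin_def using assms by (intro finprod_multf) auto
  finally show ?thesis .
qed

end

lemma free_Abelian_group_hom_eqI:
  assumes "group H" "h \<in> hom (free_Abelian_group S) H" "h' \<in> hom (free_Abelian_group S) H"
    and "\<And>k. k \<in> S \<Longrightarrow> h (frag_of k) = h' (frag_of k)" "Poly_Mapping.keys z \<subseteq> S"
  shows "h z = h' z"
proof -
  interpret h: group_hom "free_Abelian_group S" H h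
    using assms by (simp add: group_hom_def group_hom_axioms_def)
  interpret h': group_hom "free_Abelian_group S" H h'
    using assms by (simp add: group_hom_def group_hom_axioms_def)
  show ?thesis
    using \<open>Poly_Mapping.keys z \<subseteq> S\<close>
  proof (rule free_Abelian_group_induct)
    show "h 0 = h' 0" using h.hom_one h'.hom_one by simp
  next
    fix x y assume 2: "Poly_Mapping.keys x \<subseteq> S" "Poly_Mapping.keys y \<subseteq> S" "h x = h' x" "h y = h' y"
    have "h (x - y) = h x \<otimes>\<^bsub>H\<^esub> inv\<^bsub>H\<^esub> h y" "h' (x - y) = h' x \<otimes>\<^bsub>H\<^esub> inv\<^bsub>H\<^esub> h' y"
      using h.hom_mult [of x "- y"] h.hom_inv [of y] h'.hom_mult [of x "- y"] h'.hom_inv [of y] 2 by auto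
    then show "h (x - y) = h' (x - y)" using 2 by simp
  qed (use assms in auto)
qed

lemma hom_frag_lin:
  assumes "comm_group G" "comm_group H" "h \<in> hom G H"
    and u: "\<And>k. k \<in> Poly_Mapping.keys z \<Longrightarrow> u k \<in> carrier G"
  shows "h (frag_lin G u z) = frag_lin H (\<lambda>k. h (u k)) z"
proof -
  interpret G: comm_group G by fact
  interpret H: comm_group H by fact
  have hu: "h (u k) \<in> carrier H" if "k \<in> Poly_Mapping.keys z" for k
    using u [OF that] \<open>h \<in> hom G H\<close> by (auto simp: hom_def)
  have "(h \<circ> frag_lin G u) z = frag_lin H (\<lambda>k. h (u k)) z"
  proof (rule free_Abelian_group_hom_eqI)
    show "h \<circ> frag_lin G u \<in> hom (free_Abelian_group (Poly_Mapping.keys z)) H"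
      using u assms by (intro hom_compose [OF G.frag_lin_hom]) auto
    show "frag_lin H (\<lambda>k. h (u k)) \<in> hom (free_Abelian_group (Poly_Mapping.keys z)) H"
      using hu by (intro H.frag_lin_hom) auto
  qed (use u hu in auto)
  then show ?thesis by simp
qed

text \<open>Both sides are homomorphisms that agree on generators. The set \<open>S\<close> bounds
  all supports of the \<open>v k\<close> at once, so that \<open>frag_extend v\<close> lands in one
  free group.\<close>

lemma frag_lin_frag_extend:
  assumes "comm_group G" "\<And>k. k \<in> Poly_Mapping.keys z \<Longrightarrow> Poly_Mapping.keys (v k) \<subseteq> S" "u \<in> S \<rightarrow> carrier G"
  shows "frag_lin G u (frag_extend v z) = frag_lin G (\<lambda>k. frag_lin G u (v k)) z"
proof -
  interpret G: comm_group G by fact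
  have closed: "frag_lin G u (v k) \<in> carrier G" if "k \<in> Poly_Mapping.keys z" for k
    using assms that by (intro G.frag_lin_closed) blast
  have "(frag_lin G u \<circ> frag_extend v) z = frag_lin G (\<lambda>k. frag_lin G u (v k)) z"
  proof (rule free_Abelian_group_hom_eqI)
    have "frag_extend v \<in> hom (free_Abelian_group (Poly_Mapping.keys z)) (free_Abelian_group S)"
      using assms(2) keys_frag_extend [of v] by (intro homI) (fastforce simp: frag_extend_add)+
    then show "frag_lin G u \<circ> frag_extend v \<in> hom (free_Abelian_group (Poly_Mapping.keys z)) G"
      using G.frag_lin_hom [OF assms(3)] by (rule hom_compose)
    show "frag_lin G (\<lambda>k. frag_lin G u (v k)) \<in> hom (free_Abelian_group (Poly_Mapping.keys z)) G"
      using closed by (intro G.frag_lin_hom) auto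
  qed (use closed in auto)
  then show ?thesis by simp
qed

section \<open>Direct sums and homomorphisms out of them\<close>

definition sum_incl :: "'b set \<Rightarrow> ('b \<Rightarrow> ('a, 'm) monoid_scheme) \<Rightarrow> 'b \<Rightarrow> 'a \<Rightarrow> 'b \<Rightarrow> 'a" where
  "sum_incl I G b x = (\<lambda>c\<in>I. if c = b then x else \<one>\<^bsub>G c\<^esub>)"

lemma comm_group_sum_group:
  assumes "\<And>i. i \<in> I \<Longrightarrow> comm_group (G i)"
  shows "comm_group (sum_group I G)"
proof -
  have grp: "group (G i)" if "i \<in> I" for i
    using assms [OF that] by (simp add: comm_group_def)
  show ?thesis
  proof (rule group.group_comm_groupI)
    show "group (sum_group I G)"
      using grp by simp
    show "x \<otimes>\<^bsub>sum_group I G\<^esub> y = y \<otimes>\<^bsub>sum_group I G\<^esub> x"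
      if "x \<in> carrier (sum_group I G)" "y \<in> carrier (sum_group I G)" for x y
      using that by (auto simp: carrier_sum_group grp PiE_iff
          intro!: restrict_ext comm_monoid.m_comm [OF comm_group.axioms(1) [OF assms]])
  qed
qed

lemma sum_incl_hom:
  assumes "\<And>i. i \<in> I \<Longrightarrow> group (G i)" "b \<in> I"
  shows "sum_incl I G b \<in> hom (G b) (sum_group I G)"
proof (rule homI)
  fix x assume x: "x \<in> carrier (G b)"
  have "finite {i \<in> I. sum_incl I G b x i \<noteq> \<one>\<^bsub>G i\<^esub>}"
    by (rule finite_subset [of _ "{b}"]) (auto simp: sum_incl_def split: if_splits)
  then show "sum_incl I G b x \<in> carrier (sum_group I G)"
    using assms x by (auto simp: carrier_sum_group sum_incl_def group.is_monoid)
next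
  fix x y assume "x \<in> carrier (G b)" "y \<in> carrier (G b)"
  then show "sum_incl I G b (x \<otimes>\<^bsub>G b\<^esub> y) = sum_incl I G b x \<otimes>\<^bsub>sum_group I G\<^esub> sum_incl I G b y"
    using assms by (auto simp: sum_incl_def group.is_monoid monoid.l_one)
qed

lemma sum_proj_hom:
  assumes "\<And>i. i \<in> I \<Longrightarrow> group (G i)" "b \<in> I"
  shows "(\<lambda>x. x b) \<in> hom (sum_group I G) (G b)"
  using assms by (intro homI) (auto simp: carrier_sum_group)

text \<open>An element of a direct sum is a finite product of included coordinates, so a
  homomorphism is determined on the summands.\<close>

lemma sum_group_hom_eqI:
  assumes G: "\<And>i. i \<in> I \<Longrightarrow> group (G i)" and H: "group H"
    and h: "h \<in> hom (sum_group I G) H" and h': "h' \<in> hom (sum_group I G) H"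
    and eq: "\<And>b x. b \<in> I \<Longrightarrow> x \<in> carrier (G b) \<Longrightarrow> h (sum_incl I G b x) = h' (sum_incl I G b x)"
    and y: "y \<in> carrier (sum_group I G)"
  shows "h y = h' y"
proof -
  interpret h: group_hom "sum_group I G" H h
    using assms by (simp add: group_hom_def group_hom_axioms_def)
  interpret h': group_hom "sum_group I G" H h'
    using assms by (simp add: group_hom_def group_hom_axioms_def)
  \<comment> \<open>The induction runs over a finite set that only bounds the support, so that a
    coordinate can be split off whether or not it is trivial.\<close>
  have "h y = h' y" if "finite A" "y \<in> carrier (sum_group I G)" "{i \<in> I. y i \<noteq> \<one>\<^bsub>G i\<^esub>} \<subseteq> A" for A y
    using that
  proof (induction A arbitrary: y rule: finite_induct)
    case empty
    then have "y = \<one>\<^bsub>sum_group I G\<^esub>"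
      by (auto simp: carrier_sum_group G PiE_iff extensional_def)
    then show ?case
      using h.hom_one h'.hom_one by metis
  next
    case (insert b A)
    show ?case
    proof (cases "b \<in> I")
      case False
      then show ?thesis
        using insert by blast
    next
      case True
      define y' where "y' = (\<lambda>i\<in>I. if i = b then \<one>\<^bsub>G i\<^esub> else y i)"
      have "finite {i \<in> I. y' i \<noteq> \<one>\<^bsub>G i\<^esub>}"
        using insert.prems by (auto simp: carrier_sum_group G y'_def elim!: rev_finite_subset)
      then have y': "y' \<in> carrier (sum_group I G)"
        using insert.prems by (auto simp: carrier_sum_group G y'_def group.is_monoid)
      have yb: "y b \<in> carrier (G b)"
        using insert.prems True by (auto simp: carrier_sum_group G)
      have inc: "sum_incl I G b (y b) \<in> carrier (sum_group I G)"
        using sum_incl_hom [where G = G, OF G True] yb by (auto simp: hom_def)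
      have split: "y = sum_incl I G b (y b) \<otimes>\<^bsub>sum_group I G\<^esub> y'"
        using insert.prems yb
        by (auto simp: fun_eq_iff sum_incl_def y'_def carrier_sum_group G PiE_iff extensional_def
            group.is_monoid monoid.l_one monoid.r_one)
      have "h y' = h' y'"
        using insert.prems(2) by (intro insert.IH y') (auto simp: y'_def)
      then have "h (sum_incl I G b (y b) \<otimes>\<^bsub>sum_group I G\<^esub> y') = h' (sum_incl I G b (y b) \<otimes>\<^bsub>sum_group I G\<^esub> y')"
        using eq [OF True yb] inc y' by (simp only: h.hom_mult h'.hom_mult)
      then show ?thesis
        using split by simp
    qed
  qed
  then show ?thesis
    using y by (auto simp: carrier_sum_group G)
qed

section \<open>Tensoring with a natural system\<close>

locale natural_system =
  fixes n :: nat and FG :: "(nat \<Rightarrow> nat) \<Rightarrow> 'a monoid"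
    and Fm :: "(nat \<Rightarrow> nat) \<Rightarrow> (nat \<Rightarrow> nat) \<Rightarrow> (nat \<Rightarrow> nat) \<Rightarrow> 'a \<Rightarrow> 'a"
  assumes contra_natural_system: "contra_natural_system n FG Fm"
begin

lemma comm_group_FG: "\<alpha> \<in> NN n \<Longrightarrow> comm_group (FG \<alpha>)"
  using contra_natural_system by (simp add: contra_natural_system_def)

lemma group_FG: "\<alpha> \<in> NN n \<Longrightarrow> group (FG \<alpha>)"
  using comm_group_FG by (simp add: comm_group_def)

lemma Fm_hom: "\<alpha> \<in> NN n \<Longrightarrow> f \<in> NN n \<Longrightarrow> g \<in> NN n \<Longrightarrow> Fm \<alpha> f g \<in> hom (FG (\<alpha> + f + g)) (FG \<alpha>)"
  using contra_natural_system by (simp add: contra_natural_system_def)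

lemma Fm_id: "\<alpha> \<in> NN n \<Longrightarrow> x \<in> carrier (FG \<alpha>) \<Longrightarrow> Fm \<alpha> 0 0 x = x"
  using contra_natural_system by (simp add: contra_natural_system_def)

lemma Fm_comp:
  assumes "\<alpha> \<in> NN n" "f1 \<in> NN n" "g1 \<in> NN n" "f2 \<in> NN n" "g2 \<in> NN n"
    and "x \<in> carrier (FG (\<alpha> + f1 + g1 + f2 + g2))"
  shows "Fm \<alpha> f1 g1 (Fm (\<alpha> + f1 + g1) f2 g2 x) = Fm \<alpha> (f1 + f2) (g2 + g1) x"
  using contra_natural_system assms unfolding contra_natural_system_def by simp

definition chain_group :: "'b set \<Rightarrow> ('b \<Rightarrow> nat \<Rightarrow> nat) \<Rightarrow> ('b \<Rightarrow> 'a) monoid" where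
  "chain_group B ob = sum_group B (\<lambda>b. FG (ob b))"

definition cell_eval :: "'b set \<Rightarrow> ('b \<Rightarrow> nat \<Rightarrow> nat) \<Rightarrow> 'a \<Rightarrow> 'b cell \<Rightarrow> 'b \<Rightarrow> 'a" where
  "cell_eval B ob x = (\<lambda>(c, f, g). sum_incl B (\<lambda>b. FG (ob b)) c (Fm (ob c) f g x))"

definition frag_eval :: "'b set \<Rightarrow> ('b \<Rightarrow> nat \<Rightarrow> nat) \<Rightarrow> ('b cell \<Rightarrow>\<^sub>0 int) \<Rightarrow> 'a \<Rightarrow> 'b \<Rightarrow> 'a" where
  "frag_eval B ob z x = frag_lin (chain_group B ob) (cell_eval B ob x) z"

text \<open>The index set may be infinite, as for the standard complex with positive
  \<open>n\<close>, but an element of the direct sum yields only finitely many nontrivial factors;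
  hence \<open>gfinprod\<close>.\<close>

definition tensor :: "'b set \<Rightarrow> 'c set \<Rightarrow> ('c \<Rightarrow> nat \<Rightarrow> nat) \<Rightarrow> ('b \<Rightarrow> ('c cell \<Rightarrow>\<^sub>0 int)) \<Rightarrow> ('b \<Rightarrow> 'a) \<Rightarrow> 'c \<Rightarrow> 'a" where
  "tensor B B' ob' u y = gfinprod (chain_group B' ob') (\<lambda>b. frag_eval B' ob' (u b) (y b)) B"

context
  fixes B :: "'b set" and ob :: "'b \<Rightarrow> nat \<Rightarrow> nat"
  assumes ob: "\<And>b. b \<in> B \<Longrightarrow> ob b \<in> NN n"
begin

lemma comm_group_chain_group: "comm_group (chain_group B ob)"
  unfolding chain_group_def using ob comm_group_FG by (intro comm_group_sum_group) auto

lemma group_chain_group: "group (chain_group B ob)"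
  using comm_group_chain_group by (simp add: comm_group_def)

lemma sum_incl_chain_hom: "b \<in> B \<Longrightarrow> sum_incl B (\<lambda>b. FG (ob b)) b \<in> hom (FG (ob b)) (chain_group B ob)"
  unfolding chain_group_def using sum_incl_hom [of B "\<lambda>b. FG (ob b)" b] ob group_FG by auto

lemma cell_eval_hom:
  assumes "c \<in> cells n B ob \<beta>"
  shows "(\<lambda>x. cell_eval B ob x c) \<in> hom (FG \<beta>) (chain_group B ob)"
proof -
  obtain b f g where c: "c = (b, f, g)" "b \<in> B" "f \<in> NN n" "g \<in> NN n" "\<beta> = ob b + f + g"
    using assms by (auto simp: cells_def)
  have "sum_incl B (\<lambda>b. FG (ob b)) b \<circ> Fm (ob b) f g \<in> hom (FG \<beta>) (chain_group B ob)"
    using Fm_hom [OF ob] sum_incl_chain_hom c by (intro hom_compose) auto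
  then show ?thesis
    by (simp add: cell_eval_def c(1) o_def)
qed

lemma cell_eval_closed:
  "c \<in> cells n B ob \<beta> \<Longrightarrow> x \<in> carrier (FG \<beta>) \<Longrightarrow> cell_eval B ob x c \<in> carrier (chain_group B ob)"
  using cell_eval_hom by (fastforce simp: hom_def)

lemma frag_eval_hom:
  assumes "Poly_Mapping.keys z \<subseteq> cells n B ob \<beta>"
  shows "frag_eval B ob z \<in> hom (FG \<beta>) (chain_group B ob)"
proof -
  interpret C: comm_group "chain_group B ob" by (rule comm_group_chain_group)
  have closed: "cell_eval B ob x c \<in> carrier (chain_group B ob)"
    if "x \<in> carrier (FG \<beta>)" "c \<in> Poly_Mapping.keys z" for x c
    using assms that cell_eval_closed by blast
  show ?thesis
  proof (rule homI)
    fix x y assume x: "x \<in> carrier (FG \<beta>)" and y: "y \<in> carrier (FG \<beta>)"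
    have "frag_lin (chain_group B ob) (cell_eval B ob (x \<otimes>\<^bsub>FG \<beta>\<^esub> y)) z
        = frag_lin (chain_group B ob) (\<lambda>c. cell_eval B ob x c \<otimes>\<^bsub>chain_group B ob\<^esub> cell_eval B ob y c) z"
      using assms closed x y by (intro C.frag_lin_cong) (auto simp: hom_mult [OF cell_eval_hom, of _ \<beta>])
    then show "frag_eval B ob z (x \<otimes>\<^bsub>FG \<beta>\<^esub> y) = frag_eval B ob z x \<otimes>\<^bsub>chain_group B ob\<^esub> frag_eval B ob z y"
      unfolding frag_eval_def using closed x y by (simp add: C.frag_lin_mult)
  qed (auto simp: frag_eval_def intro: C.frag_lin_closed closed)
qed

lemma frag_eval_add:
  assumes "Poly_Mapping.keys z \<subseteq> cells n B ob \<beta>" "Poly_Mapping.keys w \<subseteq> cells n B ob \<beta>" "x \<in> carrier (FG \<beta>)"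
  shows "frag_eval B ob (z + w) x = frag_eval B ob z x \<otimes>\<^bsub>chain_group B ob\<^esub> frag_eval B ob w x"
  unfolding frag_eval_def using assms cell_eval_closed
  by (intro comm_group.frag_lin_add [OF comm_group_chain_group]) auto

lemma frag_eval_unit:
  assumes "b \<in> B" "x \<in> carrier (FG (ob b))"
  shows "frag_eval B ob (frag_of (b, 0, 0)) x = sum_incl B (\<lambda>b. FG (ob b)) b x"
proof -
  have "(b, 0, 0) \<in> cells n B ob (ob b)"
    using assms by (simp add: cells_def)
  then have "frag_eval B ob (frag_of (b, 0, 0)) x = cell_eval B ob x (b, 0, 0)"
    unfolding frag_eval_def using assms
    by (intro comm_group.frag_lin_of [OF comm_group_chain_group] cell_eval_closed)
  then show ?thesis
    using assms by (simp add: cell_eval_def Fm_id ob)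
qed

end

text \<open>The balancing relation of a tensor product: translating the chain amounts to applying
  \<open>F\<close> to the coefficient. On a single cell this is \<open>Fm_comp\<close>.\<close>

lemma frag_eval_shift:
  assumes ob: "\<And>b. b \<in> B \<Longrightarrow> ob b \<in> NN n" and z: "Poly_Mapping.keys z \<subseteq> cells n B ob \<beta>"
    and f: "f \<in> NN n" and g: "g \<in> NN n" and \<beta>: "\<beta> \<in> NN n" and x: "x \<in> carrier (FG (\<beta> + f + g))"
  shows "frag_eval B ob (shift f g z) x = frag_eval B ob z (Fm \<beta> f g x)"
proof -
  note C = comm_group_chain_group [of B ob, OF ob]
  let ?h = "\<lambda>(b, f', g'). frag_of (b, f + f', g + g')"
  have step: "cell_eval B ob x (b, f + f', g + g') = cell_eval B ob (Fm \<beta> f g x) (b, f', g')"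
    if "(b, f', g') \<in> cells n B ob \<beta>" for b f' g'
    using that Fm_comp [of "ob b" f' g' f g x] f g x ob
    by (auto simp: cells_def cell_eval_def add.commute)
  have Fx: "Fm \<beta> f g x \<in> carrier (FG \<beta>)"
    using Fm_hom [OF \<beta> f g] x by (auto simp: hom_def)
  have "frag_eval B ob (shift f g z) x = frag_lin (chain_group B ob) (\<lambda>k. frag_lin (chain_group B ob) (cell_eval B ob x) (?h k)) z"
    unfolding frag_eval_def shift_def
  proof (rule frag_lin_frag_extend [OF C])
    show "Poly_Mapping.keys (?h k) \<subseteq> cells n B ob (\<beta> + f + g)" if "k \<in> Poly_Mapping.keys z" for k
    proof -
      have "k \<in> cells n B ob \<beta>" using that z by blast
      from cells_shift [OF this f g] show ?thesis by (cases k) auto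
    qed
    show "cell_eval B ob x \<in> cells n B ob (\<beta> + f + g) \<rightarrow> carrier (chain_group B ob)"
      using x by (auto intro: cell_eval_closed [OF ob])
  qed auto
  also have "\<dots> = frag_lin (chain_group B ob) (cell_eval B ob (Fm \<beta> f g x)) z"
  proof (rule comm_group.frag_lin_cong [OF C])
    fix k assume "k \<in> Poly_Mapping.keys z"
    then have k: "k \<in> cells n B ob \<beta>"
      using z by blast
    show closed: "cell_eval B ob (Fm \<beta> f g x) k \<in> carrier (chain_group B ob)"
      using cell_eval_closed [OF ob k Fx] by simp
    show "frag_lin (chain_group B ob) (cell_eval B ob x) (?h k) = cell_eval B ob (Fm \<beta> f g x) k"
      using closed k by (cases k) (auto simp: comm_group.frag_lin_of [OF C] step)
  qed auto
  finally show ?thesis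
    by (simp add: frag_eval_def)
qed

context
  fixes B :: "'b set" and ob :: "'b \<Rightarrow> nat \<Rightarrow> nat" and B' :: "'c set" and ob' :: "'c \<Rightarrow> nat \<Rightarrow> nat"
  assumes ob: "\<And>b. b \<in> B \<Longrightarrow> ob b \<in> NN n" and ob': "\<And>b. b \<in> B' \<Longrightarrow> ob' b \<in> NN n"
begin

lemma tensor_hom:
  assumes "\<And>b. b \<in> B \<Longrightarrow> Poly_Mapping.keys (u b) \<subseteq> cells n B' ob' (ob b)"
  shows "tensor B B' ob' u \<in> hom (chain_group B ob) (chain_group B' ob')"
  unfolding tensor_def [abs_def] chain_group_def [of B]
proof (rule comm_group.hom_group_sum)
  show "frag_eval B' ob' (u b) \<in> hom (FG (ob b)) (chain_group B' ob')" if "b \<in> B" for b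
    using ob' assms [OF that] by (rule frag_eval_hom)
  show "comm_group (chain_group B' ob')"
    using ob' by (rule comm_group_chain_group)
qed (use ob group_FG in auto)

lemma tensor_sum_incl:
  assumes u: "\<And>b. b \<in> B \<Longrightarrow> Poly_Mapping.keys (u b) \<subseteq> cells n B' ob' (ob b)"
    and b: "b \<in> B" and x: "x \<in> carrier (FG (ob b))"
  shows "tensor B B' ob' u (sum_incl B (\<lambda>b. FG (ob b)) b x) = frag_eval B' ob' (u b) x"
proof -
  let ?y = "sum_incl B (\<lambda>b. FG (ob b)) b x"
  interpret C: comm_group "chain_group B' ob'"
    using ob' by (rule comm_group_chain_group)
  have y: "?y i \<in> carrier (FG (ob i))" if "i \<in> B" for i
    using that x ob group_FG by (auto simp: sum_incl_def group.is_monoid)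
  have hom: "frag_eval B' ob' (u i) \<in> hom (FG (ob i)) (chain_group B' ob')" if "i \<in> B" for i
    using u that by (intro frag_eval_hom ob')
  have "tensor B B' ob' u ?y = gfinprod (chain_group B' ob') (\<lambda>i. frag_eval B' ob' (u i) (?y i)) {b}"
    unfolding tensor_def
  proof (rule C.gfinprod_mono_neutral_cong_right)
    show "frag_eval B' ob' (u i) (?y i) = \<one>\<^bsub>chain_group B' ob'\<^esub>" if "i \<in> B - {b}" for i
      using that hom_one [OF hom, of i] ob group_FG C.is_group by (auto simp: sum_incl_def)
    show "(\<lambda>i. frag_eval B' ob' (u i) (?y i)) \<in> B \<rightarrow> carrier (chain_group B' ob')"
      using hom y by (fastforce simp: hom_def)
  qed (use b in auto)
  also have "\<dots> = frag_eval B' ob' (u b) x"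
    using hom [OF b] b x y [OF b] by (auto simp: sum_incl_def hom_def Pi_iff)
  finally show ?thesis .
qed

text \<open>The main tool for identities between tensored maps: each reduces to one summand, where
  \<open>tensor_sum_incl\<close> computes the right-hand side.\<close>

lemma tensor_eqI:
  assumes u: "\<And>b. b \<in> B \<Longrightarrow> Poly_Mapping.keys (u b) \<subseteq> cells n B' ob' (ob b)"
    and h: "h \<in> hom (chain_group B ob) (chain_group B' ob')"
    and eq: "\<And>b x. b \<in> B \<Longrightarrow> x \<in> carrier (FG (ob b)) \<Longrightarrow>
        h (sum_incl B (\<lambda>b. FG (ob b)) b x) = frag_eval B' ob' (u b) x"
    and y: "y \<in> carrier (chain_group B ob)"
  shows "h y = tensor B B' ob' u y"
proof (rule sum_group_hom_eqI [of B "\<lambda>b. FG (ob b)" "chain_group B' ob'"])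
  show "h \<in> hom (sum_group B (\<lambda>b. FG (ob b))) (chain_group B' ob')"
    using h by (simp add: chain_group_def)
  show "tensor B B' ob' u \<in> hom (sum_group B (\<lambda>b. FG (ob b))) (chain_group B' ob')"
    using tensor_hom [OF u] by (simp add: chain_group_def)
qed (use assms tensor_sum_incl ob ob' group_FG group_chain_group in \<open>auto simp: chain_group_def\<close>)

lemma tensor_cong:
  assumes "\<And>b. b \<in> B \<Longrightarrow> u b = v b"
    and v: "\<And>b. b \<in> B \<Longrightarrow> Poly_Mapping.keys (v b) \<subseteq> cells n B' ob' (ob b)"
    and y: "y \<in> carrier (chain_group B ob)"
  shows "tensor B B' ob' u y = tensor B B' ob' v y"
proof (rule tensor_eqI [OF v _ _ y])
  show "tensor B B' ob' u \<in> hom (chain_group B ob) (chain_group B' ob')"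
    using assms by (intro tensor_hom) auto
  show "tensor B B' ob' u (sum_incl B (\<lambda>b. FG (ob b)) b x) = frag_eval B' ob' (v b) x"
    if "b \<in> B" "x \<in> carrier (FG (ob b))" for b x
    using tensor_sum_incl [of u b x] assms that by auto
qed

lemma tensor_add:
  assumes u: "\<And>b. b \<in> B \<Longrightarrow> Poly_Mapping.keys (u b) \<subseteq> cells n B' ob' (ob b)"
    and v: "\<And>b. b \<in> B \<Longrightarrow> Poly_Mapping.keys (v b) \<subseteq> cells n B' ob' (ob b)"
    and y: "y \<in> carrier (chain_group B ob)"
  shows "tensor B B' ob' (\<lambda>b. u b + v b) y
    = tensor B B' ob' u y \<otimes>\<^bsub>chain_group B' ob'\<^esub> tensor B B' ob' v y"
proof (rule tensor_eqI [symmetric, OF _ _ _ y])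
  interpret C: comm_group "chain_group B' ob'"
    using ob' by (rule comm_group_chain_group)
  show "Poly_Mapping.keys (u b + v b) \<subseteq> cells n B' ob' (ob b)" if "b \<in> B" for b
    using u [OF that] v [OF that] keys_add [of "u b" "v b"] by blast
  have "(\<lambda>y. tensor B B' ob' u y) \<in> hom (chain_group B ob) (chain_group B' ob')"
     "(\<lambda>y. tensor B B' ob' v y) \<in> hom (chain_group B ob) (chain_group B' ob')"
    using tensor_hom [OF u] tensor_hom [OF v] by auto
  then show "(\<lambda>y. tensor B B' ob' u y \<otimes>\<^bsub>chain_group B' ob'\<^esub> tensor B B' ob' v y)
      \<in> hom (chain_group B ob) (chain_group B' ob')"
    by (auto simp: hom_def Pi_iff C.m_ac)
  show "tensor B B' ob' u (sum_incl B (\<lambda>b. FG (ob b)) b x) \<otimes>\<^bsub>chain_group B' ob'\<^esub>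
      tensor B B' ob' v (sum_incl B (\<lambda>b. FG (ob b)) b x) = frag_eval B' ob' (u b + v b) x"
    if "b \<in> B" "x \<in> carrier (FG (ob b))" for b x
    using tensor_sum_incl [OF u] tensor_sum_incl [OF v] frag_eval_add [OF ob' u v] that by simp
qed

end

lemma tensor_id:
  assumes ob: "\<And>b. b \<in> B \<Longrightarrow> ob b \<in> NN n" and y: "y \<in> carrier (chain_group B ob)"
  shows "tensor B B ob (\<lambda>b. frag_of (b, 0, 0)) y = y"
proof -
  have "id y = tensor B B ob (\<lambda>b. frag_of (b, 0, 0)) y"
  proof (rule tensor_eqI [where ob = ob, OF ob ob _ _ _ y])
    show "Poly_Mapping.keys (frag_of (b, 0, 0)) \<subseteq> cells n B ob (ob b)" if "b \<in> B" for b
      using that by (simp add: cells_def)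
    show "id \<in> hom (chain_group B ob) (chain_group B ob)"
      by (simp add: hom_def)
    show "id (sum_incl B (\<lambda>b. FG (ob b)) b x) = frag_eval B ob (frag_of (b, 0, 0)) x"
      if "b \<in> B" "x \<in> carrier (FG (ob b))" for b x
      using frag_eval_unit [where ob = ob, OF ob that] by simp
  qed
  then show ?thesis by simp
qed

lemma tensor_zero:
  assumes ob: "\<And>b. b \<in> B \<Longrightarrow> ob b \<in> NN n" and ob': "\<And>b. b \<in> B' \<Longrightarrow> ob' b \<in> NN n"
    and y: "y \<in> carrier (chain_group B ob)"
  shows "tensor B B' ob' (\<lambda>b. 0) y = \<one>\<^bsub>chain_group B' ob'\<^esub>"
proof -
  interpret C: comm_group "chain_group B' ob'"
    using ob' by (rule comm_group_chain_group)
  show ?thesis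
    by (simp add: tensor_def frag_eval_def gfinprod_def)
qed

text \<open>Functoriality of tensoring. On a summand the two sides differ by whether a factorization
  acts on the coefficient or translates the chain \<open>v c\<close>, and
  \<open>frag_eval_shift\<close> identifies these.\<close>

lemma tensor_tensor:
  assumes ob: "\<And>b. b \<in> B \<Longrightarrow> ob b \<in> NN n" and ob': "\<And>b. b \<in> B' \<Longrightarrow> ob' b \<in> NN n"
    and ob'': "\<And>b. b \<in> B'' \<Longrightarrow> ob'' b \<in> NN n"
    and u: "\<And>b. b \<in> B \<Longrightarrow> Poly_Mapping.keys (u b) \<subseteq> cells n B' ob' (ob b)"
    and v: "\<And>b. b \<in> B' \<Longrightarrow> Poly_Mapping.keys (v b) \<subseteq> cells n B'' ob'' (ob' b)"
    and y: "y \<in> carrier (chain_group B ob)"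
  shows "tensor B' B'' ob'' v (tensor B B' ob' u y) = tensor B B'' ob'' (\<lambda>b. nat_ext v (u b)) y"
proof -
  note C = comm_group_chain_group [of B' ob', OF ob'] and C' = comm_group_chain_group [of B'' ob'', OF ob'']
  have "(tensor B' B'' ob'' v \<circ> tensor B B' ob' u) y = tensor B B'' ob'' (\<lambda>b. nat_ext v (u b)) y"
  proof (rule tensor_eqI [OF ob ob'' _ _ _ y])
    show "Poly_Mapping.keys (nat_ext v (u b)) \<subseteq> cells n B'' ob'' (ob b)" if "b \<in> B" for b
      using u [OF that] v by (rule keys_nat_ext)
    show "tensor B' B'' ob'' v \<circ> tensor B B' ob' u \<in> hom (chain_group B ob) (chain_group B'' ob'')"
      using tensor_hom [OF ob ob' u] tensor_hom [OF ob' ob'' v] by (rule hom_compose)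
    fix b x assume b: "b \<in> B" and x: "x \<in> carrier (FG (ob b))"
    let ?v = "\<lambda>(c, f, g). shift f g (v c)"
    have Fm_x: "Fm (ob' c) f g x \<in> carrier (FG (ob' c))" if "(c, f, g) \<in> cells n B' ob' (ob b)" for c f g
      using that x Fm_hom [of "ob' c" f g] ob' by (auto simp: cells_def hom_def)
    have sh: "frag_eval B'' ob'' (shift f g (v c)) x = frag_eval B'' ob'' (v c) (Fm (ob' c) f g x)"
      "Poly_Mapping.keys (shift f g (v c)) \<subseteq> cells n B'' ob'' (ob b)"
      if "(c, f, g) \<in> cells n B' ob' (ob b)" for c f g
      using that x frag_eval_shift [OF ob'' v, of c f g x] keys_shift [OF v, of c f g] ob'
      by (auto simp: cells_def)
    have "(tensor B' B'' ob'' v \<circ> tensor B B' ob' u) (sum_incl B (\<lambda>b. FG (ob b)) b x)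
        = tensor B' B'' ob'' v (frag_eval B' ob' (u b) x)"
      using tensor_sum_incl [where ob = ob and ob' = ob', OF ob ob' u b x] by simp
    also have "\<dots> = frag_lin (chain_group B'' ob'') (\<lambda>c. tensor B' B'' ob'' v (cell_eval B' ob' x c)) (u b)"
      unfolding frag_eval_def
    proof (rule hom_frag_lin [where h = "tensor B' B'' ob'' v", OF C C'])
      show "tensor B' B'' ob'' v \<in> hom (chain_group B' ob') (chain_group B'' ob'')"
        using ob' ob'' v by (rule tensor_hom)
      show "cell_eval B' ob' x k \<in> carrier (chain_group B' ob')" if "k \<in> Poly_Mapping.keys (u b)" for k
        using u [OF b] that x by (intro cell_eval_closed ob') blast+
    qed
    also have "\<dots> = frag_lin (chain_group B'' ob'') (\<lambda>k. frag_eval B'' ob'' (?v k) x) (u b)"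
    proof (rule comm_group.frag_lin_cong [OF C'])
      fix k assume "k \<in> Poly_Mapping.keys (u b)"
      with u [OF b] have k: "k \<in> cells n B' ob' (ob b)"
        by blast
      obtain c f g where k_eq: "k = (c, f, g)"
        by (cases k)
      have c: "c \<in> B'"
        using k k_eq by (simp add: cells_def)
      show "tensor B' B'' ob'' v (cell_eval B' ob' x k) = frag_eval B'' ob'' (?v k) x"
        using tensor_sum_incl [OF ob' ob'' v c Fm_x] sh(1) k by (simp add: k_eq cell_eval_def)
      have "frag_eval B'' ob'' (?v k) \<in> hom (FG (ob b)) (chain_group B'' ob'')"
        using sh(2) k k_eq by (intro frag_eval_hom ob'') auto
      then show "frag_eval B'' ob'' (?v k) x \<in> carrier (chain_group B'' ob'')"
        using x by (auto simp: hom_def)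
    qed
    also have "\<dots> = frag_eval B'' ob'' (nat_ext v (u b)) x"
      unfolding frag_eval_def nat_ext_def
    proof (rule frag_lin_frag_extend [symmetric, OF C'])
      show "Poly_Mapping.keys (?v k) \<subseteq> cells n B'' ob'' (ob b)" if "k \<in> Poly_Mapping.keys (u b)" for k
      proof -
        have "k \<in> cells n B' ob' (ob b)"
          using u [OF b] that by blast
        then show ?thesis
          using sh(2) by (cases k) auto
      qed
      show "cell_eval B'' ob'' x \<in> cells n B'' ob'' (ob b) \<rightarrow> carrier (chain_group B'' ob'')"
        using x by (auto intro: cell_eval_closed [OF ob''])
    qed auto
    finally show "(tensor B' B'' ob'' v \<circ> tensor B B' ob' u) (sum_incl B (\<lambda>b. FG (ob b)) b x)
        = frag_eval B'' ob'' (nat_ext v (u b)) x" .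
  qed
  then show ?thesis by simp
qed

text \<open>\<open>tensor\<close> multiplies over source generators, while \<open>face_sum\<close>
  collects for each target all pairs of a generator and a face index. The comparison is an exchange
  of finite products in each coordinate.\<close>

lemma face_sum_eq_tensor:
  fixes B B' :: "'b set" and ob :: "'b \<Rightarrow> nat \<Rightarrow> nat"
  assumes ob: "\<And>b. b \<in> B \<Longrightarrow> ob b \<in> NN n" and ob': "\<And>b. b \<in> B' \<Longrightarrow> ob b \<in> NN n"
    and J: "finite J"
    and d: "\<And>b. b \<in> B \<Longrightarrow> d b = (\<Sum>j\<in>J. frag_cmul (sg j) (frag_of (face j b, f j b, g j b)))"
    and cell: "\<And>b j. b \<in> B \<Longrightarrow> j \<in> J \<Longrightarrow> (face j b, f j b, g j b) \<in> cells n B' ob (ob b)"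
    and coef: "\<And>b j x. b \<in> B \<Longrightarrow> j \<in> J \<Longrightarrow> x \<in> carrier (FG (ob b)) \<Longrightarrow>
        coef j b x = Fm (ob (face j b)) (f j b) (g j b) x"
    and y: "y \<in> carrier (chain_group B ob)"
  shows "face_sum (\<lambda>b. FG (ob b)) B B' J face coef sg y = tensor B B' ob d y"
proof -
  interpret C: comm_group "chain_group B' ob"
    using ob' by (rule comm_group_chain_group)
  let ?A = "{b \<in> B. y b \<noteq> \<one>\<^bsub>FG (ob b)\<^esub>}"
  have keys_d: "Poly_Mapping.keys (d b) \<subseteq> cells n B' ob (ob b)" if "b \<in> B" for b
    unfolding d [OF that] using cell that by (intro order_trans [OF keys_sum]) (auto split: if_splits)
  have grp: "group (FG (ob b))" if "b \<in> B" for b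
    using that ob group_FG by blast
  have yb: "y b \<in> carrier (FG (ob b))" if "b \<in> B" for b
    using y that by (auto simp: chain_group_def carrier_sum_group grp)
  have fin: "finite ?A"
    using y by (auto simp: chain_group_def carrier_sum_group grp)
  have ev_hom: "frag_eval B' ob (d b) \<in> hom (FG (ob b)) (chain_group B' ob)" if "b \<in> B" for b
    using ob' keys_d [OF that] by (rule frag_eval_hom)
  have ev: "frag_eval B' ob (d b) (y b) \<in> carrier (chain_group B' ob)" if "b \<in> B" for b
    using ev_hom [OF that] yb [OF that] by (auto simp: hom_def)
  have "tensor B B' ob d y = gfinprod (chain_group B' ob) (\<lambda>b. frag_eval B' ob (d b) (y b)) ?A"
    unfolding tensor_def
  proof (rule C.gfinprod_mono_neutral_cong_right)
    show "frag_eval B' ob (d b) (y b) = \<one>\<^bsub>chain_group B' ob\<^esub>" if "b \<in> B - ?A" for b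
      using that hom_one [OF ev_hom grp C.is_group] by auto
  qed (use ev in auto)
  also have "\<dots> = finprod (chain_group B' ob) (\<lambda>b. frag_eval B' ob (d b) (y b)) ?A"
    using fin ev by (intro C.gfinprod_eq_finprod) auto
  finally have T: "tensor B B' ob d y = finprod (chain_group B' ob) (\<lambda>b. frag_eval B' ob (d b) (y b)) ?A" .
  have comp: "tensor B B' ob d y c = finprod (FG (ob c)) (\<lambda>(b, j). coef j b (y b) [^]\<^bsub>FG (ob c)\<^esub> sg j)
      {(b, j). b \<in> B \<and> y b \<noteq> \<one>\<^bsub>FG (ob b)\<^esub> \<and> j \<in> J \<and> face j b = c}" if c: "c \<in> B'" for c
  proof -
    interpret G: comm_group "FG (ob c)"
      using ob' c comm_group_FG by blast
    have proj: "(\<lambda>x. x c) \<in> hom (chain_group B' ob) (FG (ob c))"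
      unfolding chain_group_def using sum_proj_hom [of B' "\<lambda>b. FG (ob b)" c] ob' group_FG c by auto
    have cl: "Fm (ob (face j b)) (f j b) (g j b) (y b) \<in> carrier (FG (ob (face j b)))"
      if "b \<in> B" "j \<in> J" for b j
      using Fm_hom [of "ob (face j b)" "f j b" "g j b"] cell [OF that] ob' yb [OF that(1)]
      by (auto simp: cells_def hom_def)
    have coef_closed: "coef j b (y b) \<in> carrier (FG (ob c))" if "b \<in> B" "j \<in> J" "face j b = c" for b j
      using cl [OF that(1,2)] coef [OF that(1,2) yb [OF that(1)]] that(3) by simp
    have "tensor B B' ob d y c = finprod (FG (ob c)) (\<lambda>b. frag_eval B' ob (d b) (y b) c) ?A"
    proof -
      interpret proj: group_hom "chain_group B' ob" "FG (ob c)" "\<lambda>x. x c"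
        using proj by unfold_locales
      have "finprod (chain_group B' ob) (\<lambda>b. frag_eval B' ob (d b) (y b)) A c
          = finprod (FG (ob c)) (\<lambda>b. frag_eval B' ob (d b) (y b) c) A" if "finite A" "A \<subseteq> ?A" for A
        using that
      proof (induction A rule: finite_induct)
        case empty
        then show ?case using proj.hom_one by simp
      next
        case (insert b A)
        have "(\<lambda>b. frag_eval B' ob (d b) (y b)) \<in> A \<rightarrow> carrier (chain_group B' ob)"
          "(\<lambda>b. frag_eval B' ob (d b) (y b) c) \<in> A \<rightarrow> carrier (FG (ob c))"
          "frag_eval B' ob (d b) (y b) \<in> carrier (chain_group B' ob)"
          using insert.prems ev proj.hom_closed by auto
        then show ?case
          using insert proj.hom_mult proj.hom_closed by auto
      qed
      then show ?thesis
        using T fin by simp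
    qed
    \<comment> \<open>The inner product is indexed by pairs with first component \<open>b\<close>,
      so that the index sets for different \<open>b\<close> are disjoint and unite to the index set
      of \<open>face_sum\<close>.\<close>
    also have "\<dots> = finprod (FG (ob c)) (\<lambda>b. finprod (FG (ob c)) (\<lambda>(b, j). coef j b (y b) [^]\<^bsub>FG (ob c)\<^esub> sg j)
        (Pair b ` {j \<in> J. face j b = c})) ?A"
    proof (rule G.finprod_cong')
      show "(\<lambda>b. finprod (FG (ob c)) (\<lambda>(b, j). coef j b (y b) [^]\<^bsub>FG (ob c)\<^esub> sg j)
          (Pair b ` {j \<in> J. face j b = c})) \<in> ?A \<rightarrow> carrier (FG (ob c))"
        using coef_closed by (auto intro!: G.finprod_closed G.int_pow_closed)
      fix b assume "b \<in> ?A"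
      then have b: "b \<in> B" by simp
      define u where "u k = cell_eval B' ob (y b) k c" for k
      \<comment> \<open>A face different from \<open>c\<close> lies in another summand and
        contributes the unit to coordinate \<open>c\<close>.\<close>
      have u: "u (face j b, f j b, g j b) = (if face j b = c then coef j b (y b) else \<one>\<^bsub>FG (ob c)\<^esub>)" if "j \<in> J" for j
        using c coef [OF b that yb [OF b]] by (auto simp: u_def cell_eval_def sum_incl_def)
      have "frag_eval B' ob (d b) (y b) c = frag_lin (FG (ob c)) u (d b)"
        unfolding frag_eval_def u_def
      proof (rule hom_frag_lin [where h = "\<lambda>x. x c", OF C.comm_group_axioms G.comm_group_axioms proj])
        show "cell_eval B' ob (y b) k \<in> carrier (chain_group B' ob)" if "k \<in> Poly_Mapping.keys (d b)" for k
          using keys_d [OF b] that yb [OF b] by (intro cell_eval_closed ob') blast+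
      qed
      also have "\<dots> = finprod (FG (ob c)) (\<lambda>j. u (face j b, f j b, g j b) [^]\<^bsub>FG (ob c)\<^esub> sg j) J"
        unfolding d [OF b] using u coef_closed b by (intro G.frag_lin_sum J) auto
      also have "\<dots> = finprod (FG (ob c)) (\<lambda>j. coef j b (y b) [^]\<^bsub>FG (ob c)\<^esub> sg j) {j \<in> J. face j b = c}"
        using u coef_closed b J by (intro G.finprod_mono_neutral_cong_right) auto
      also have "\<dots> = finprod (FG (ob c)) (\<lambda>(b, j). coef j b (y b) [^]\<^bsub>FG (ob c)\<^esub> sg j)
          (Pair b ` {j \<in> J. face j b = c})"
        using coef_closed b by (subst G.finprod_reindex) (auto simp: inj_on_def intro!: G.int_pow_closed)
      finally show "frag_eval B' ob (d b) (y b) c = \<dots>" .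
    qed auto
    also have "\<dots> = finprod (FG (ob c)) (\<lambda>(b, j). coef j b (y b) [^]\<^bsub>FG (ob c)\<^esub> sg j)
        (\<Union>b \<in> ?A. Pair b ` {j \<in> J. face j b = c})"
      using fin J coef_closed by (intro G.finprod_UN_disjoint [symmetric]) (auto simp: pairwise_def disjnt_def intro!: G.int_pow_closed)
    also have "(\<Union>b \<in> ?A. Pair b ` {j \<in> J. face j b = c})
        = {(b, j). b \<in> B \<and> y b \<noteq> \<one>\<^bsub>FG (ob b)\<^esub> \<and> j \<in> J \<and> face j b = c}"
      by auto
    finally show ?thesis .
  qed
  \<comment> \<open>Elements of the direct sum are extensional, so agreement of the coordinates in
    \<open>B'\<close> is enough.\<close>
  have "tensor B B' ob d y \<in> carrier (chain_group B' ob)"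
    using tensor_hom [where ob = ob, OF ob ob' keys_d] y by (auto simp: hom_def)
  then have ext: "tensor B B' ob d y \<in> extensional B'"
    using ob' group_FG by (auto simp: chain_group_def carrier_sum_group PiE_def)
  show ?thesis
    unfolding face_sum_def
  proof (rule extensionalityI [OF _ ext])
    fix c assume "c \<in> B'"
    then show "restrict (\<lambda>c'. finprod (FG (ob c')) (\<lambda>(c, j). coef j c (y c) [^]\<^bsub>FG (ob c')\<^esub> sg j)
        {(c, j). c \<in> B \<and> y c \<noteq> \<one>\<^bsub>FG (ob c)\<^esub> \<and> j \<in> J \<and> face j c = c'}) B' c = tensor B B' ob d y c"
      using comp by simp
  qed auto
qed

end

section \<open>Homology of homotopy equivalent complexes\<close>

definition cycles :: "(nat \<Rightarrow> ('a, 'm) monoid_scheme) \<Rightarrow> (nat \<Rightarrow> 'a \<Rightarrow> 'a) \<Rightarrow> nat \<Rightarrow> 'a set" where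
  "cycles C d k = (if k = 0 then carrier (C 0) else kernel (C k) (C (k - 1)) (d k))"

locale chain_complex =
  fixes C :: "nat \<Rightarrow> ('a, 'm) monoid_scheme" and d :: "nat \<Rightarrow> 'a \<Rightarrow> 'a"
  assumes comm_group_C: "comm_group (C k)"
    and d_hom: "d (Suc k) \<in> hom (C (Suc k)) (C k)"
    and d_d_one: "x \<in> carrier (C (Suc (Suc k))) \<Longrightarrow> d (Suc k) (d (Suc (Suc k)) x) = \<one>\<^bsub>C k\<^esub>"
begin

lemma group_C: "group (C k)"
  using comm_group_C by (simp add: comm_group_def)

lemma subgroup_cycles: "subgroup (cycles C d k) (C k)"
proof (cases k)
  case 0
  then show ?thesis
    by (simp add: cycles_def group.subgroup_self group_C)
next
  case (Suc j)
  interpret group_hom "C k" "C j" "d k"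
    using d_hom [of j] Suc group_C by (simp add: group_hom_def group_hom_axioms_def)
  show ?thesis
    using subgroup_kernel Suc by (simp add: cycles_def)
qed

lemma subgroup_boundaries: "subgroup (d (Suc k) ` carrier (C (Suc k))) (C k)"
proof -
  interpret group_hom "C (Suc k)" "C k" "d (Suc k)"
    using d_hom group_C by (simp add: group_hom_def group_hom_axioms_def)
  show ?thesis
    by (rule img_is_subgroup)
qed

lemma boundaries_subset_cycles: "d (Suc k) ` carrier (C (Suc k)) \<subseteq> cycles C d k"
proof (cases k)
  case 0
  then show ?thesis
    using subgroup.subset [OF subgroup_boundaries] by (simp add: cycles_def)
next
  case (Suc j)
  then show ?thesis
    using subgroup.subset [OF subgroup_boundaries [of k]] d_d_one by (auto simp: cycles_def kernel_def)
qed

abbreviation boundaries :: "nat \<Rightarrow> 'a set" where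
  "boundaries k \<equiv> d (Suc k) ` carrier (C (Suc k))"

abbreviation cycle_group :: "nat \<Rightarrow> ('a, 'm) monoid_scheme" where
  "cycle_group k \<equiv> subgroup_generated (C k) (cycles C d k)"

lemma carrier_cycle_group: "carrier (cycle_group k) = cycles C d k"
  by (rule subgroup.carrier_subgroup_generated_subgroup [OF subgroup_cycles])

lemma comm_group_cycle_group: "comm_group (cycle_group k)"
  using group.abelian_subgroup_generated [OF group_C comm_group_C] .

lemma boundaries_normal: "boundaries k \<lhd> cycle_group k"
  using group.subgroup_of_subgroup_generated [OF group_C boundaries_subset_cycles subgroup_boundaries]
  by (rule comm_group.normal_iff_subgroup [OF comm_group_cycle_group, THEN iffD2])

lemma chain_homology_eq: "chain_homology C d k = cycle_group k Mod boundaries k"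
  by (simp add: chain_homology_def cycles_def)

end

lemma chain_map_cycles:
  assumes "chain_complex C d" "chain_complex C' d'"
    and \<phi>: "\<And>k. \<phi> k \<in> hom (C k) (C' k)"
    and comm: "\<And>k x. x \<in> carrier (C (Suc k)) \<Longrightarrow> d' (Suc k) (\<phi> (Suc k) x) = \<phi> k (d (Suc k) x)"
    and x: "x \<in> cycles C d k"
  shows "\<phi> k x \<in> cycles C' d' k"
proof -
  interpret C: chain_complex C d by fact
  interpret C': chain_complex C' d' by fact
  have xC: "x \<in> carrier (C k)"
    using x C.subgroup_cycles subgroup.subset by blast
  then have "\<phi> k x \<in> carrier (C' k)"
    using \<phi> [of k] by (auto simp: hom_def)
  then show ?thesis
    using x xC comm hom_one [OF \<phi> C.group_C C'.group_C]
    by (cases k) (auto simp: cycles_def kernel_def)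
qed

text \<open>First isomorphism theorem for the map from cycles of \<open>C\<close> to homology of
  \<open>C'\<close>. The homotopies are required on cycles only, where just the term
  \<open>d w\<close> is left of them.\<close>

lemma chain_homology_iso:
  assumes "chain_complex C d" "chain_complex C' d'"
    and \<phi>: "\<And>k. \<phi> k \<in> hom (C k) (C' k)"
      "\<And>k x. x \<in> carrier (C (Suc k)) \<Longrightarrow> d' (Suc k) (\<phi> (Suc k) x) = \<phi> k (d (Suc k) x)"
    and \<psi>: "\<And>k. \<psi> k \<in> hom (C' k) (C k)"
      "\<And>k x. x \<in> carrier (C' (Suc k)) \<Longrightarrow> d (Suc k) (\<psi> (Suc k) x) = \<psi> k (d' (Suc k) x)"
    and \<psi>\<phi>: "\<And>k x. x \<in> cycles C d k \<Longrightarrow> \<exists>w \<in> carrier (C (Suc k)). \<psi> k (\<phi> k x) = x \<otimes>\<^bsub>C k\<^esub> d (Suc k) w"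
    and \<phi>\<psi>: "\<And>k x. x \<in> cycles C' d' k \<Longrightarrow> \<exists>w \<in> carrier (C' (Suc k)). \<phi> k (\<psi> k x) = x \<otimes>\<^bsub>C' k\<^esub> d' (Suc k) w"
  shows "chain_homology C d k \<cong> chain_homology C' d' k"
proof -
  interpret C: chain_complex C d by fact
  interpret C': chain_complex C' d' by fact
  interpret Ck: comm_group "C k" by (rule C.comm_group_C)
  interpret Z: comm_group "C.cycle_group k" by (rule C.comm_group_cycle_group)
  interpret Z': comm_group "C'.cycle_group k" by (rule C'.comm_group_cycle_group)
  interpret B: normal "C.boundaries k" "C.cycle_group k" by (rule C.boundaries_normal)
  interpret B': normal "C'.boundaries k" "C'.cycle_group k" by (rule C'.boundaries_normal)
  have \<phi>_cyc: "\<phi> k x \<in> cycles C' d' k" if "x \<in> cycles C d k" for x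
    using chain_map_cycles [OF assms(1,2) \<phi> that] .
  have \<psi>_cyc: "\<psi> k x \<in> cycles C d k" if "x \<in> cycles C' d' k" for x
    using chain_map_cycles [OF assms(2,1) \<psi> that] .
  have cyc: "x \<in> carrier (C k)" if "x \<in> cycles C d k" for x
    using that C.subgroup_cycles subgroup.subset by blast
  have \<phi>_hom: "\<phi> k \<in> hom (C.cycle_group k) (C'.cycle_group k)"
    using \<phi>(1) [of k] \<phi>_cyc cyc by (intro homI) (auto simp: C.carrier_cycle_group C'.carrier_cycle_group hom_def)
  define q where "q x = C'.boundaries k #>\<^bsub>C'.cycle_group k\<^esub> x" for x
  have q_one: "q x = \<one>\<^bsub>C'.cycle_group k Mod C'.boundaries k\<^esub> \<longleftrightarrow> x \<in> C'.boundaries k"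
    if "x \<in> cycles C' d' k" for x
    using that Z'.coset_join1 [of "C'.boundaries k" x] Z'.coset_join2 [of x "C'.boundaries k"]
      B'.subgroup_axioms B'.subset
    by (auto simp: q_def FactGroup_def C'.carrier_cycle_group)
  have q_hom: "q \<in> hom (C'.cycle_group k) (C'.cycle_group k Mod C'.boundaries k)"
    unfolding q_def using B'.r_coset_hom_Mod .
  interpret M': group "C'.cycle_group k Mod C'.boundaries k"
    by (rule B'.factorgroup_is_group)
  interpret q: group_hom "C'.cycle_group k" "C'.cycle_group k Mod C'.boundaries k" q
    using q_hom by unfold_locales
  interpret h: group_hom "C.cycle_group k" "C'.cycle_group k Mod C'.boundaries k" "q \<circ> \<phi> k"
    using hom_compose [OF \<phi>_hom q_hom] by unfold_locales
  have "kernel (C.cycle_group k) (C'.cycle_group k Mod C'.boundaries k) (q \<circ> \<phi> k) = C.boundaries k"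
  proof (intro subset_antisym subsetI)
    fix x assume "x \<in> kernel (C.cycle_group k) (C'.cycle_group k Mod C'.boundaries k) (q \<circ> \<phi> k)"
    then have x: "x \<in> cycles C d k" and "\<phi> k x \<in> C'.boundaries k"
      using q_one \<phi>_cyc by (auto simp: kernel_def C.carrier_cycle_group)
    then obtain v where v: "v \<in> carrier (C' (Suc k))" "\<phi> k x = d' (Suc k) v"
      by blast
    obtain w where w: "w \<in> carrier (C (Suc k))" "\<psi> k (\<phi> k x) = x \<otimes>\<^bsub>C k\<^esub> d (Suc k) w"
      using \<psi>\<phi> [OF x] by blast
    \<comment> \<open>\<open>\<psi>\<close> carries the boundary \<open>\<phi> k x\<close> to a
      boundary, and the homotopy says that \<open>x\<close> differs from the result by another
      boundary.\<close>
    have "\<psi> (Suc k) v \<in> carrier (C (Suc k))"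
      using v \<psi>(1) [of "Suc k"] by (auto simp: hom_def)
    then have v': "\<psi> k (\<phi> k x) \<in> C.boundaries k"
      using v \<psi>(2) [OF v(1)] by (metis imageI)
    have w': "d (Suc k) w \<in> C.boundaries k" "d (Suc k) w \<in> carrier (C k)"
      using w C.d_hom [of k] by (auto simp: hom_def)
    then have "x = \<psi> k (\<phi> k x) \<otimes>\<^bsub>C k\<^esub> inv\<^bsub>C k\<^esub> d (Suc k) w"
      using w cyc [OF x] by (simp add: Ck.m_assoc)
    then show "x \<in> C.boundaries k"
      using v' w' C.subgroup_boundaries [of k] subgroup.m_closed subgroup.m_inv_closed by metis
  next
    fix x assume x: "x \<in> C.boundaries k"
    then obtain w where w: "w \<in> carrier (C (Suc k))" "x = d (Suc k) w"
      by blast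
    then have "\<phi> k x = d' (Suc k) (\<phi> (Suc k) w)" "\<phi> (Suc k) w \<in> carrier (C' (Suc k))"
      using \<phi>(1) [of "Suc k"] \<phi>(2) by (auto simp: hom_def)
    then have "\<phi> k x \<in> C'.boundaries k"
      by blast
    moreover have xc: "x \<in> cycles C d k"
      using x C.boundaries_subset_cycles by blast
    ultimately show "x \<in> kernel (C.cycle_group k) (C'.cycle_group k Mod C'.boundaries k) (q \<circ> \<phi> k)"
      using q_one \<phi>_cyc by (auto simp: kernel_def C.carrier_cycle_group)
  qed
  \<comment> \<open>The class of a cycle \<open>y\<close> is the image of \<open>\<psi> k y\<close>,
    because \<open>\<phi> k (\<psi> k y)\<close> differs from \<open>y\<close> by a
    boundary.\<close>
  moreover have "(q \<circ> \<phi> k) ` carrier (C.cycle_group k) = carrier (C'.cycle_group k Mod C'.boundaries k)"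
  proof (intro subset_antisym subsetI)
    fix X assume "X \<in> carrier (C'.cycle_group k Mod C'.boundaries k)"
    then obtain y where y: "y \<in> cycles C' d' k" "X = q y"
      by (auto simp: carrier_FactGroup q_def C'.carrier_cycle_group)
    obtain w where w: "w \<in> carrier (C' (Suc k))" "\<phi> k (\<psi> k y) = y \<otimes>\<^bsub>C' k\<^esub> d' (Suc k) w"
      using \<phi>\<psi> [OF y(1)] by blast
    have dw: "d' (Suc k) w \<in> C'.boundaries k" "d' (Suc k) w \<in> cycles C' d' k"
      using w C'.boundaries_subset_cycles by blast+
    have "q (\<phi> k (\<psi> k y)) = q y \<otimes>\<^bsub>C'.cycle_group k Mod C'.boundaries k\<^esub> q (d' (Suc k) w)"
      using q.hom_mult [of y "d' (Suc k) w"] y dw w by (simp add: C'.carrier_cycle_group)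
    also have "\<dots> = X"
      using q_one [OF dw(2)] dw(1) y q.hom_closed [of y] M'.r_one
      by (simp del: one_FactGroup mult_FactGroup add: C'.carrier_cycle_group)
    finally show "X \<in> (q \<circ> \<phi> k) ` carrier (C.cycle_group k)"
      using \<psi>_cyc [OF y(1)] by (force simp: C.carrier_cycle_group)
  qed (use h.hom_closed in auto)
  ultimately show ?thesis
    using h.FactGroup_iso by (simp add: C.chain_homology_eq C'.chain_homology_eq)
qed

section \<open>Chain maps and homotopies after tensoring\<close>

context natural_system
begin

text \<open>The differential \<open>\<delta>\<close> is compared with the tensored boundary on
  chains only, which is the form in which \<open>face_sum_eq_tensor\<close> delivers the
  comparison.\<close>

lemma chain_complex_tensor:
  assumes "acyclic_complex n B ob d"
    and C: "\<And>k. C k = chain_group (B k) ob"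
    and \<delta>: "\<And>k y. y \<in> carrier (C (Suc k)) \<Longrightarrow> \<delta> (Suc k) y = tensor (B (Suc k)) (B k) ob d y"
  shows "chain_complex C \<delta>"
proof -
  interpret acyclic_complex n B ob d by fact
  have hom: "tensor (B (Suc k)) (B k) ob d \<in> hom (C (Suc k)) (C k)" for k
    unfolding C using ob_in ob_in keys_d by (rule tensor_hom)
  show ?thesis
  proof (rule chain_complex.intro)
    show "comm_group (C k)" for k
      unfolding C using ob_in by (rule comm_group_chain_group)
    show \<delta>_hom: "\<delta> (Suc k) \<in> hom (C (Suc k)) (C k)" for k
      using hom [of k] \<delta> [of _ k] group.is_monoid [OF group_chain_group [where ob = ob, OF ob_in]]
      by (auto simp: hom_def Pi_iff C monoid.m_closed)
    fix k x assume x: "x \<in> carrier (C (Suc (Suc k)))"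
    then have "\<delta> (Suc (Suc k)) x \<in> carrier (C (Suc k))"
      using \<delta>_hom [of "Suc k"] by (auto simp: hom_def)
    then have "\<delta> (Suc k) (\<delta> (Suc (Suc k)) x)
        = tensor (B (Suc k)) (B k) ob d (tensor (B (Suc (Suc k))) (B (Suc k)) ob d x)"
      using \<delta> x by simp
    also have "\<dots> = tensor (B (Suc (Suc k))) (B k) ob (\<lambda>b. nat_ext d (d b)) x"
      using ob_in ob_in ob_in keys_d keys_d x [unfolded C] by (rule tensor_tensor)
    also have "\<dots> = tensor (B (Suc (Suc k))) (B k) ob (\<lambda>b. 0) x"
      using x [unfolded C] by (intro tensor_cong [where ob = ob] ob_in) (auto intro: d_d)
    also have "\<dots> = \<one>\<^bsub>C k\<^esub>"
      unfolding C using ob_in ob_in x [unfolded C] by (rule tensor_zero)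
    finally show "\<delta> (Suc k) (\<delta> (Suc (Suc k)) x) = \<one>\<^bsub>C k\<^esub>" .
  qed
qed

lemma tensor_chain_map:
  assumes "acyclic_complex n B ob d" "acyclic_complex n B' ob' d'"
    and chain_map: "chain_map n B ob d B' ob' d' \<phi>"
    and x: "x \<in> carrier (chain_group (B (Suc k)) ob)"
  shows "tensor (B' (Suc k)) (B' k) ob' d' (tensor (B (Suc k)) (B' (Suc k)) ob' (\<phi> (Suc k)) x)
    = tensor (B k) (B' k) ob' (\<phi> k) (tensor (B (Suc k)) (B k) ob d x)"
proof -
  interpret P: acyclic_complex n B ob d by fact
  interpret Q: acyclic_complex n B' ob' d' by fact
  note \<phi> = chain_mapD(2,3) [OF chain_map]
  have "tensor (B' (Suc k)) (B' k) ob' d' (tensor (B (Suc k)) (B' (Suc k)) ob' (\<phi> (Suc k)) x)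
      = tensor (B (Suc k)) (B' k) ob' (\<lambda>b. nat_ext d' (\<phi> (Suc k) b)) x"
    using P.ob_in Q.ob_in Q.ob_in \<phi>(1) Q.keys_d x by (rule tensor_tensor)
  also have "\<dots> = tensor (B (Suc k)) (B' k) ob' (\<lambda>b. nat_ext (\<phi> k) (d b)) x"
    using P.ob_in Q.ob_in \<phi>(2) keys_nat_ext [OF P.keys_d \<phi>(1)] x by (rule tensor_cong)
  also have "\<dots> = tensor (B k) (B' k) ob' (\<phi> k) (tensor (B (Suc k)) (B k) ob d x)"
    using P.ob_in P.ob_in Q.ob_in P.keys_d \<phi>(1) x by (rule tensor_tensor [symmetric])
  finally show ?thesis .
qed

text \<open>Tensoring turns the homotopy into \<open>x + d (s x) + s (d x)\<close>, written
  additively, and the last term vanishes on a cycle.\<close>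

lemma tensor_round_trip:
  assumes P: "acyclic_complex n B ob d" and Q: "acyclic_complex n B' ob' d'"
    and C: "\<And>k. C k = chain_group (B k) ob"
    and \<delta>: "\<And>k y. y \<in> carrier (C (Suc k)) \<Longrightarrow> \<delta> (Suc k) y = tensor (B (Suc k)) (B k) ob d y"
    and chain_map_\<phi>: "chain_map n B ob d B' ob' d' \<phi>"
    and chain_map_\<psi>: "chain_map n B' ob' d' B ob d \<psi>"
    and homotopy: "homotopy_to_id n B ob d (\<lambda>k b. nat_ext (\<psi> k) (\<phi> k b)) s"
    and x: "x \<in> cycles C \<delta> k"
  shows "\<exists>w \<in> carrier (C (Suc k)). tensor (B' k) (B k) ob (\<psi> k) (tensor (B k) (B' k) ob' (\<phi> k) x)
      = x \<otimes>\<^bsub>C k\<^esub> \<delta> (Suc k) w"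
proof -
  interpret P: acyclic_complex n B ob d by fact
  interpret Q: acyclic_complex n B' ob' d' by fact
  interpret CC: chain_complex C \<delta>
    using P C \<delta> by (rule chain_complex_tensor)
  interpret Ck: comm_group "C k" by (rule CC.comm_group_C)
  note \<phi> = chain_mapD(2) [OF chain_map_\<phi>] and \<psi> = chain_mapD(2) [OF chain_map_\<psi>]
    and s = homotopy_to_idD [OF homotopy]
  have xC: "x \<in> carrier (C k)"
    using x CC.subgroup_cycles subgroup.subset by blast
  let ?w = "tensor (B k) (B (Suc k)) ob (s k) x"
  have w: "?w \<in> carrier (C (Suc k))"
    using tensor_hom [of "B k" ob "B (Suc k)" ob "s k"] P.ob_in s(1) xC by (auto simp: C hom_def)
  have unit: "Poly_Mapping.keys (frag_of (b, 0, 0)) \<subseteq> cells n (B k) ob (ob b)" if "b \<in> B k" for b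
    using that by (simp add: cells_def)
  have ds: "Poly_Mapping.keys (nat_ext d (s k b)) \<subseteq> cells n (B k) ob (ob b)" if "b \<in> B k" for b
    using s(1) [OF that] P.keys_d by (rule keys_nat_ext)
  have uds: "Poly_Mapping.keys (frag_of (b, 0, 0) + nat_ext d (s k b)) \<subseteq> cells n (B k) ob (ob b)"
    if "b \<in> B k" for b
    using unit [OF that] ds [OF that] by (intro order_trans [OF keys_add] Un_least)
  have "tensor (B k) (B k) ob (\<lambda>b. frag_of (b, 0, 0) + nat_ext d (s k b)) x
      = tensor (B k) (B k) ob (\<lambda>b. frag_of (b, 0, 0)) x \<otimes>\<^bsub>C k\<^esub> tensor (B k) (B k) ob (\<lambda>b. nat_ext d (s k b)) x"
    unfolding C using P.ob_in P.ob_in unit ds xC [unfolded C] by (rule tensor_add)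
  also have "tensor (B k) (B k) ob (\<lambda>b. frag_of (b, 0, 0)) x = x"
    using P.ob_in xC [unfolded C] by (rule tensor_id)
  also have "tensor (B k) (B k) ob (\<lambda>b. nat_ext d (s k b)) x = tensor (B (Suc k)) (B k) ob d ?w"
    using P.ob_in P.ob_in P.ob_in s(1) P.keys_d xC [unfolded C] by (rule tensor_tensor [symmetric])
  also have "\<dots> = \<delta> (Suc k) ?w"
    using \<delta> [OF w] by simp
  finally have main: "tensor (B k) (B k) ob (\<lambda>b. frag_of (b, 0, 0) + nat_ext d (s k b)) x
      = x \<otimes>\<^bsub>C k\<^esub> \<delta> (Suc k) ?w" .
  have "tensor (B' k) (B k) ob (\<psi> k) (tensor (B k) (B' k) ob' (\<phi> k) x)
      = tensor (B k) (B k) ob (\<lambda>b. nat_ext (\<psi> k) (\<phi> k b)) x"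
    using P.ob_in Q.ob_in P.ob_in \<phi> \<psi> xC [unfolded C] by (rule tensor_tensor)
  also have "\<dots> = tensor (B k) (B k) ob (\<lambda>b. frag_of (b, 0, 0) + nat_ext d (s k b)) x"
  proof (cases k)
    case 0
    have "nat_ext (\<psi> k) (\<phi> k b) = frag_of (b, 0, 0) + nat_ext d (s k b)" if "b \<in> B k" for b
      using s(2) that 0 by simp
    with P.ob_in P.ob_in show ?thesis
      using uds xC [unfolded C] by (rule tensor_cong)
  next
    case (Suc j)
    have keys_sd: "Poly_Mapping.keys (nat_ext (s j) (d b)) \<subseteq> cells n (B k) ob (ob b)" if "b \<in> B k" for b
      using keys_nat_ext [OF P.keys_d s(1)] that unfolding Suc by blast
    have "tensor (B k) (B k) ob (\<lambda>b. nat_ext (\<psi> k) (\<phi> k b)) x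
        = tensor (B k) (B k) ob (\<lambda>b. (frag_of (b, 0, 0) + nat_ext d (s k b)) + nat_ext (s j) (d b)) x"
    proof (rule tensor_cong [where ob = ob, OF P.ob_in P.ob_in _ _ xC [unfolded C]])
      show "nat_ext (\<psi> k) (\<phi> k b) = frag_of (b, 0, 0) + nat_ext d (s k b) + nat_ext (s j) (d b)" if "b \<in> B k" for b
        using s(3) that Suc by simp
      show "Poly_Mapping.keys (frag_of (b, 0, 0) + nat_ext d (s k b) + nat_ext (s j) (d b))
          \<subseteq> cells n (B k) ob (ob b)" if "b \<in> B k" for b
        using uds [OF that] keys_sd [OF that] by (rule order_trans [OF keys_add Un_least])
    qed
    also have "\<dots> = tensor (B k) (B k) ob (\<lambda>b. frag_of (b, 0, 0) + nat_ext d (s k b)) x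
        \<otimes>\<^bsub>C k\<^esub> tensor (B k) (B k) ob (\<lambda>b. nat_ext (s j) (d b)) x"
      unfolding C using P.ob_in P.ob_in uds keys_sd xC [unfolded C] by (rule tensor_add)
    also have "tensor (B k) (B k) ob (\<lambda>b. nat_ext (s j) (d b)) x
        = tensor (B j) (B k) ob (s j) (tensor (B k) (B j) ob d x)"
      using tensor_tensor [where ob = ob, OF P.ob_in P.ob_in P.ob_in P.keys_d s(1)] xC
      unfolding C Suc by simp
    \<comment> \<open>The only place where \<open>x\<close> being a cycle is used: its boundary is
      trivial, so the homotopy applied to it is trivial too.\<close>
    also have "tensor (B k) (B j) ob d x = \<one>\<^bsub>C j\<^esub>"
      using x xC \<delta> [of x j] Suc by (simp add: cycles_def kernel_def)
    also have "tensor (B j) (B k) ob (s j) \<one>\<^bsub>C j\<^esub> = \<one>\<^bsub>C k\<^esub>"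
    proof -
      have "tensor (B j) (B k) ob (s j) \<in> hom (C j) (C k)"
        unfolding C Suc using P.ob_in P.ob_in s(1) by (rule tensor_hom)
      then show ?thesis
        using CC.group_C CC.group_C by (rule hom_one)
    qed
    finally show ?thesis
      using main w xC CC.d_hom [of k] by (auto simp: hom_def Pi_iff)
  qed
  finally show ?thesis
    using main w by metis
qed

text \<open>Both complexes are free resolutions of the constant functor with value the integers, so
  after tensoring with \<open>F\<close> they compute the same Tor groups.\<close>

theorem acyclic_complexes_homology_iso:
  assumes P: "acyclic_complex n B ob d" and Q: "acyclic_complex n B' ob' d'"
    and C: "\<And>k. C k = chain_group (B k) ob" and C': "\<And>k. C' k = chain_group (B' k) ob'"
    and \<delta>: "\<And>k y. y \<in> carrier (C (Suc k)) \<Longrightarrow> \<delta> (Suc k) y = tensor (B (Suc k)) (B k) ob d y"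
    and \<delta>': "\<And>k y. y \<in> carrier (C' (Suc k)) \<Longrightarrow> \<delta>' (Suc k) y = tensor (B' (Suc k)) (B' k) ob' d' y"
  shows "chain_homology C \<delta> k \<cong> chain_homology C' \<delta>' k"
proof -
  interpret P: acyclic_complex n B ob d by fact
  interpret Q: acyclic_complex n B' ob' d' by fact
  obtain \<phi> where map_\<phi>: "chain_map n B ob d B' ob' d' \<phi>"
    using P Q by (rule chain_map_exists)
  obtain \<psi> where map_\<psi>: "chain_map n B' ob' d' B ob d \<psi>"
    using Q P by (rule chain_map_exists)
  obtain s where s: "homotopy_to_id n B ob d (\<lambda>k b. nat_ext (\<psi> k) (\<phi> k b)) s"
    using P map_\<phi> map_\<psi> by (rule round_trip_homotopy_exists)
  obtain t where t: "homotopy_to_id n B' ob' d' (\<lambda>k b. nat_ext (\<phi> k) (\<psi> k b)) t"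
    using Q map_\<psi> map_\<phi> by (rule round_trip_homotopy_exists)
  note \<phi> = chain_mapD [OF map_\<phi>] and \<psi> = chain_mapD [OF map_\<psi>]
  have complex: "chain_complex C \<delta>" "chain_complex C' \<delta>'"
    using chain_complex_tensor [OF P C \<delta>] chain_complex_tensor [OF Q C' \<delta>'] by auto
  interpret CC: chain_complex C \<delta> by (rule complex)
  interpret CC': chain_complex C' \<delta>' by (rule complex)
  let ?\<Phi> = "\<lambda>k. tensor (B k) (B' k) ob' (\<phi> k)" and ?\<Psi> = "\<lambda>k. tensor (B' k) (B k) ob (\<psi> k)"
  have \<Phi>: "?\<Phi> k \<in> hom (C k) (C' k)" for k
    unfolding C C' using P.ob_in Q.ob_in \<phi>(2) by (rule tensor_hom)
  have \<Psi>: "?\<Psi> k \<in> hom (C' k) (C k)" for k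
    unfolding C C' using Q.ob_in P.ob_in \<psi>(2) by (rule tensor_hom)
  show ?thesis
  proof (rule chain_homology_iso [where \<phi> = ?\<Phi> and \<psi> = ?\<Psi>, OF complex \<Phi> _ \<Psi>])
    show "\<delta>' (Suc k) (?\<Phi> (Suc k) x) = ?\<Phi> k (\<delta> (Suc k) x)" if "x \<in> carrier (C (Suc k))" for k x
    proof -
      have "?\<Phi> (Suc k) x \<in> carrier (C' (Suc k))"
        using \<Phi> [of "Suc k"] that by (auto simp: hom_def)
      then show ?thesis
        using tensor_chain_map [OF P Q map_\<phi> that [unfolded C]] that by (simp add: \<delta> \<delta>')
    qed
    show "\<delta> (Suc k) (?\<Psi> (Suc k) x) = ?\<Psi> k (\<delta>' (Suc k) x)" if "x \<in> carrier (C' (Suc k))" for k x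
    proof -
      have "?\<Psi> (Suc k) x \<in> carrier (C (Suc k))"
        using \<Psi> [of "Suc k"] that by (auto simp: hom_def)
      then show ?thesis
        using tensor_chain_map [OF Q P map_\<psi> that [unfolded C']] that by (simp add: \<delta> \<delta>')
    qed
    show "\<exists>w \<in> carrier (C (Suc k)). ?\<Psi> k (?\<Phi> k x) = x \<otimes>\<^bsub>C k\<^esub> \<delta> (Suc k) w" if "x \<in> cycles C \<delta> k" for k x
      using P Q C \<delta> map_\<phi> map_\<psi> s that by (rule tensor_round_trip)
    show "\<exists>w \<in> carrier (C' (Suc k)). ?\<Phi> k (?\<Psi> k x) = x \<otimes>\<^bsub>C' k\<^esub> \<delta>' (Suc k) w" if "x \<in> cycles C' \<delta>' k" for k x
      using Q P C' \<delta>' map_\<psi> map_\<phi> t that by (rule tensor_round_trip)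
  qed
qed

end

section \<open>The standard complex is acyclic\<close>

definition leech_ob :: "lchain \<Rightarrow> nat \<Rightarrow> nat" where
  "leech_ob ch = lobj ch 0"

text \<open>Only face 0 drops \<open>c_0\<close> and thereby changes the object of the chain; the
  dropped morphism is recorded as the factorization. All other faces keep \<open>c_0\<close> and
  carry the identity.\<close>

definition leech_cell :: "nat \<Rightarrow> nat \<Rightarrow> lchain \<Rightarrow> lchain cell" where
  "leech_cell k i ch =
    (leech_face k i ch, if i = 0 then fst (snd ch ! 0) else 0, if i = 0 then snd (snd ch ! 0) else 0)"

definition leech_bd :: "lchain \<Rightarrow> (lchain cell \<Rightarrow>\<^sub>0 int)" where
  "leech_bd ch = (if snd ch = [] then 0 else
    (\<Sum>i\<in>{0..length (snd ch)}. frag_cmul ((- 1) ^ i) (frag_of (leech_cell (length (snd ch)) i ch))))"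

text \<open>The value of the contracting homotopy on a cell: the factorization becomes the first morphism
  of the chain, which is the usual contraction of the nerve of a category with a terminal object.\<close>

definition leech_cone :: "lchain cell \<Rightarrow> lchain cell" where
  "leech_cone = (\<lambda>((c, ms), f, g). ((c, (f, g) # ms), 0, 0))"

definition leech_contraction :: "(lchain cell \<Rightarrow>\<^sub>0 int) \<Rightarrow> (lchain cell \<Rightarrow>\<^sub>0 int)" where
  "leech_contraction = frag_extend (\<lambda>x. frag_of (leech_cone x))"

lemma lobj_Nil [simp]: "lobj (c, []) j = c"
  by (simp add: lobj_def)

lemma lobj_Cons_Suc: "lobj (c, m # ms) (Suc j) = lobj (c, ms) j"
proof -
  have "(\<Sum>i\<in>{Suc j..<Suc (length ms)}. fst ((m # ms) ! i) + snd ((m # ms) ! i))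
      = (\<Sum>i\<in>{j..<length ms}. fst (ms ! i) + snd (ms ! i))"
    by (subst sum.shift_bounds_Suc_ivl) simp
  then show ?thesis
    by (simp add: lobj_def)
qed

lemma leech_ob_Nil [simp]: "leech_ob (c, []) = c"
  by (simp add: leech_ob_def)

lemma leech_ob_Cons: "leech_ob (c, (f, g) # ms) = leech_ob (c, ms) + f + g"
proof -
  have "lobj (c, (f, g) # ms) 0 = lobj (c, (f, g) # ms) 1 + f + g"
    by (simp add: lobj_def sum.atLeast_Suc_lessThan add_ac)
  then show ?thesis
    by (simp add: leech_ob_def lobj_Cons_Suc)
qed

lemma leech_chains_Nil [simp]: "(c, []) \<in> leech_chains n k \<longleftrightarrow> k = 0 \<and> c \<in> NN n"
  by (auto simp: leech_chains_def)

lemma leech_chains_Cons [simp]: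
  "(c, (f, g) # ms) \<in> leech_chains n (Suc k) \<longleftrightarrow> (c, ms) \<in> leech_chains n k \<and> f \<in> NN n \<and> g \<in> NN n"
  by (auto simp: leech_chains_def)

lemma leech_chains_SucE:
  assumes "ch \<in> leech_chains n (Suc k)"
  obtains c f g ms where "ch = (c, (f, g) # ms)" "(c, ms) \<in> leech_chains n k" "f \<in> NN n" "g \<in> NN n"
proof -
  obtain c fg ms where "ch = (c, fg # ms)"
    using assms by (cases ch) (auto simp: leech_chains_def length_Suc_conv)
  with assms show thesis
    using that by (cases fg) auto
qed

lemma leech_chains_0E:
  assumes "ch \<in> leech_chains n 0"
  obtains c where "ch = (c, [])" "c \<in> NN n"
  using assms by (cases ch) (auto simp: leech_chains_def)

lemma leech_ob_in_NN: "ch \<in> leech_chains n k \<Longrightarrow> leech_ob ch \<in> NN n"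
proof (induction k arbitrary: ch)
  case 0
  then show ?case
    by (elim leech_chains_0E) simp
next
  case (Suc k)
  then show ?case
    by (elim leech_chains_SucE) (simp add: leech_ob_Cons)
qed

lemma leech_cell_0: "leech_cell k 0 (c, (f, g) # ms) = ((c, ms), f, g)"
  by (simp add: leech_cell_def leech_face_def)

lemma leech_cell_1: "leech_cell (Suc 0) (Suc 0) (c, [(f, g)]) = ((c + f + g, []), 0, 0)"
  using leech_ob_Cons [of c f g "[]"]
  by (simp add: leech_cell_def leech_face_def leech_ob_def)

text \<open>Every face of a cone except face 0 is the cone over a face of the base, translated by
  \<open>(f, g)\<close>. For \<open>i = 0\<close> the translation is exactly the composition of the
  first two morphisms performed by face 1.\<close>

lemma leech_cell_Suc:
  assumes "length ms = Suc k" "i \<le> Suc k" "leech_cell (Suc k) i (c, ms) = (b, f', g')"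
  shows "leech_cell (Suc (Suc k)) (Suc i) (c, (f, g) # ms) = leech_cone (b, f + f', g + g')"
proof (cases "i = 0")
  case True
  then show ?thesis
    using assms by (cases ms) (auto simp: leech_cell_def leech_face_def leech_cone_def)
next
  case False
  then obtain j where i: "i = Suc j"
    using not0_implies_Suc by blast
  show ?thesis
  proof (cases "i < Suc k")
    case True
    then show ?thesis
      using assms i by (auto simp: leech_cell_def leech_face_def leech_cone_def)
  next
    case False
    then have "i = Suc k"
      using assms by simp
    moreover have "ms \<noteq> []"
      using assms by auto
    ultimately show ?thesis
      using assms by (auto simp: leech_cell_def leech_face_def leech_cone_def lobj_Cons_Suc)
  qed
qed

lemma leech_cone_cells:
  assumes "x \<in> cells n (leech_chains n k) leech_ob \<beta>"
  shows "leech_cone x \<in> cells n (leech_chains n (Suc k)) leech_ob \<beta>"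
  using assms by (auto simp: cells_def leech_cone_def leech_ob_Cons)

lemma leech_cell_cells:
  assumes "ch \<in> leech_chains n (Suc k)" "i \<le> Suc k"
  shows "leech_cell (Suc k) i ch \<in> cells n (leech_chains n k) leech_ob (leech_ob ch)"
  using assms
proof (induction k arbitrary: ch i)
  case 0
  obtain c f g where "ch = (c, [(f, g)])" "c \<in> NN n" "f \<in> NN n" "g \<in> NN n"
    using 0(1) by (elim leech_chains_SucE leech_chains_0E) auto
  moreover have "i = 0 \<or> i = Suc 0"
    using 0(2) by auto
  ultimately show ?case
    by (auto simp: leech_cell_0 leech_cell_1 cells_def leech_ob_Cons)
next
  case (Suc k)
  obtain c f g ms where ch: "ch = (c, (f, g) # ms)" "(c, ms) \<in> leech_chains n (Suc k)" "f \<in> NN n" "g \<in> NN n"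
    using Suc.prems(1) by (rule leech_chains_SucE)
  show ?case
  proof (cases i)
    case 0
    then show ?thesis
      using ch by (simp add: leech_cell_0 cells_def leech_ob_Cons)
  next
    case i: (Suc j)
    obtain b f' g' where cell: "leech_cell (Suc k) j (c, ms) = (b, f', g')"
      by (cases "leech_cell (Suc k) j (c, ms)")
    have len: "length ms = Suc k"
      using ch by (simp add: leech_chains_def)
    have "(b, f', g') \<in> cells n (leech_chains n k) leech_ob (leech_ob (c, ms))"
      using Suc.IH [OF ch(2), of j] Suc.prems(2) i cell by simp
    from leech_cone_cells [OF cells_shift [OF this ch(3,4)]]
    show ?thesis
      using leech_cell_Suc [OF len _ cell, of f g] Suc.prems(2) i ch(1) by (simp add: leech_ob_Cons)
  qed
qed

lemma keys_leech_bd: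
  assumes "ch \<in> leech_chains n (Suc k)"
  shows "Poly_Mapping.keys (leech_bd ch) \<subseteq> cells n (leech_chains n k) leech_ob (leech_ob ch)"
proof -
  have "length (snd ch) = Suc k"
    using assms by (auto simp: leech_chains_def)
  then have "leech_bd ch = (\<Sum>i\<in>{0..Suc k}. frag_cmul ((- 1) ^ i) (frag_of (leech_cell (Suc k) i ch)))"
    by (auto simp: leech_bd_def)
  moreover have "Poly_Mapping.keys (frag_cmul ((- 1) ^ i) (frag_of (leech_cell (Suc k) i ch)))
      \<subseteq> cells n (leech_chains n k) leech_ob (leech_ob ch)" if "i \<in> {0..Suc k}" for i
    using leech_cell_cells [OF assms, of i] that by (intro order_trans [OF keys_cmul]) simp
  ultimately show ?thesis
    by (simp only: order_trans [OF keys_sum UN_least])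
qed

lemma leech_bd_1: "leech_bd (c, [(f, g)]) = frag_of ((c, []), f, g) - frag_of ((c + f + g, []), 0, 0)"
  by (simp add: leech_bd_def leech_cell_0 leech_cell_1)

lemma leech_contraction_diff: "leech_contraction (x - y) = leech_contraction x - leech_contraction y"
  by (simp add: leech_contraction_def frag_extend_diff)

lemma leech_contraction_of [simp]: "leech_contraction (frag_of x) = frag_of (leech_cone x)"
  by (simp add: leech_contraction_def)

lemma leech_contraction_zero [simp]: "leech_contraction 0 = 0"
  by (simp add: leech_contraction_def)

text \<open>Face 0 of a cone returns its base together with the factorization. The other faces are
  cones over the faces of the base, and the shift of the index by one produces the minus
  sign.\<close>

lemma leech_bd_Cons:
  assumes "length ms = Suc k"
  shows "leech_bd (c, (f, g) # ms) = frag_of ((c, ms), f, g) - leech_contraction (shift f g (leech_bd (c, ms)))"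
proof -
  have bd: "leech_bd (c, ms) = (\<Sum>i\<in>{0..Suc k}. frag_cmul ((- 1) ^ i) (frag_of (leech_cell (Suc k) i (c, ms))))"
    using assms by (auto simp: leech_bd_def)
  have cone: "frag_of (leech_cell (Suc (Suc k)) (Suc i) (c, (f, g) # ms))
      = leech_contraction (shift f g (frag_of (leech_cell (Suc k) i (c, ms))))" if "i \<le> Suc k" for i
  proof -
    obtain b f' g' where cell: "leech_cell (Suc k) i (c, ms) = (b, f', g')"
      by (cases "leech_cell (Suc k) i (c, ms)")
    show ?thesis
      using leech_cell_Suc [OF assms that cell, of f g] cell by simp
  qed
  have "leech_bd (c, (f, g) # ms)
      = (\<Sum>i\<in>{0..Suc (Suc k)}. frag_cmul ((- 1) ^ i) (frag_of (leech_cell (Suc (Suc k)) i (c, (f, g) # ms))))"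
    using assms by (simp add: leech_bd_def)
  also have "\<dots> = frag_of ((c, ms), f, g)
      + (\<Sum>i\<in>{0..Suc k}. frag_cmul ((- 1) ^ Suc i) (frag_of (leech_cell (Suc (Suc k)) (Suc i) (c, (f, g) # ms))))"
    by (subst sum.atLeast0_atMost_Suc_shift) (simp add: leech_cell_0)
  also have "(\<Sum>i\<in>{0..Suc k}. frag_cmul ((- 1) ^ Suc i) (frag_of (leech_cell (Suc (Suc k)) (Suc i) (c, (f, g) # ms))))
      = (\<Sum>i\<in>{0..Suc k}. - frag_cmul ((- 1) ^ i) (leech_contraction (shift f g (frag_of (leech_cell (Suc k) i (c, ms))))))"
    by (rule sum.cong) (auto simp: cone)
  also have "\<dots> = - leech_contraction (shift f g (leech_bd (c, ms)))"
    by (simp only: bd shift_sum finite_atLeastAtMost shift_cmul leech_contraction_def frag_extend_sum o_def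
        frag_extend_cmul sum_negf)
  finally show ?thesis by simp
qed

lemma keys_leech_contraction:
  assumes "Poly_Mapping.keys z \<subseteq> cells n (leech_chains n k) leech_ob \<beta>"
  shows "Poly_Mapping.keys (leech_contraction z) \<subseteq> cells n (leech_chains n (Suc k)) leech_ob \<beta>"
proof -
  have "Poly_Mapping.keys (leech_contraction z) \<subseteq> leech_cone ` Poly_Mapping.keys z"
    unfolding leech_contraction_def by (rule order_trans [OF keys_frag_extend]) auto
  then show ?thesis
    using assms leech_cone_cells by blast
qed

text \<open>The homotopy identity \<open>d h + h d = 1\<close> in positive degrees. On a cell it is
  \<open>leech_bd_Cons\<close>, whose last term contains the boundary of that cell.\<close>

lemma leech_bd_contraction:
  assumes "Poly_Mapping.keys z \<subseteq> cells n (leech_chains n (Suc k)) leech_ob \<beta>"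
  shows "nat_ext leech_bd (leech_contraction z) = z - leech_contraction (nat_ext leech_bd z)"
  using assms
proof (induction z rule: frag_induction)
  case (one x)
  then obtain c ms f g where "x = ((c, ms), f, g)" "length ms = Suc k"
    by (auto simp: cells_def leech_chains_def)
  then show ?case
    by (simp add: leech_cone_def leech_bd_Cons)
next
  case (diff a b)
  then show ?case
    by (simp add: leech_contraction_diff nat_ext_diff algebra_simps)
qed auto

text \<open>In degree 0 the cone is an edge to the terminal factorization, in which the middle
  factor is all of \<beta>.\<close>

lemma leech_bd_contraction_0:
  assumes "x \<in> cells n (leech_chains n 0) leech_ob \<beta>"
  shows "nat_ext leech_bd (frag_of (leech_cone x)) = frag_of x - frag_of ((\<beta>, []), 0, 0)"
  using assms by (auto simp: cells_def leech_cone_def leech_bd_1 elim!: leech_chains_0E)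

text \<open>The contraction identity together with induction replaces the simplicial identities, since every
  chain of positive length is a cone.\<close>

lemma leech_bd_leech_bd:
  assumes "ch \<in> leech_chains n (Suc (Suc k))"
  shows "nat_ext leech_bd (leech_bd ch) = 0"
  using assms
proof (induction k arbitrary: ch)
  case 0
  obtain c f g f' g' where ch: "ch = (c, [(f, g), (f', g')])" "c \<in> NN n" "f \<in> NN n" "g \<in> NN n" "f' \<in> NN n" "g' \<in> NN n"
    using 0 by (elim leech_chains_SucE leech_chains_0E) auto
  \<comment> \<open>Degree 0 of the contraction has an extra terminal vertex, hence the separate
    base case. Here \<open>x\<close> and \<open>y\<close> are the end points of the translated edge,
    and the terminal vertices of their cones cancel.\<close>
  have x: "((c, []), f + f', g + g') \<in> cells n (leech_chains n 0) leech_ob (c + f' + g' + f + g)"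
    and y: "((c + f' + g', []), f, g) \<in> cells n (leech_chains n 0) leech_ob (c + f' + g' + f + g)"
    using ch by (auto simp: cells_def add_ac)
  show ?case
    using leech_bd_contraction_0 [OF x] leech_bd_contraction_0 [OF y]
    by (simp add: ch(1) leech_bd_Cons leech_bd_1 shift_diff nat_ext_diff leech_contraction_diff)
next
  case (Suc k)
  obtain c f g ms where ch: "ch = (c, (f, g) # ms)" "(c, ms) \<in> leech_chains n (Suc (Suc k))" "f \<in> NN n" "g \<in> NN n"
    using Suc.prems(1) by (rule leech_chains_SucE)
  let ?w = "shift f g (leech_bd (c, ms))"
  have len: "length ms = Suc (Suc k)"
    using ch by (simp add: leech_chains_def)
  have "nat_ext leech_bd ?w = 0"
    using Suc.IH [OF ch(2)] by (simp add: nat_ext_shift)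
  then have "nat_ext leech_bd (leech_contraction ?w) = ?w"
    using leech_bd_contraction [OF keys_shift [OF keys_leech_bd [OF ch(2)] ch(3,4)]] by simp
  then show ?case
    by (simp add: ch(1) leech_bd_Cons [OF len] nat_ext_diff)
qed

lemma acyclic_leech: "acyclic_complex n (leech_chains n) leech_ob leech_bd"
proof
  show "\<exists>x \<in> cells n (leech_chains n 0) leech_ob (leech_ob ch).
      \<exists>y \<in> cells n (leech_chains n 0) leech_ob (leech_ob ch). leech_bd ch = frag_of x - frag_of y"
    if ch_1: "ch \<in> leech_chains n 1" for ch
  proof -
    obtain c f g where ch: "ch = (c, [(f, g)])" "c \<in> NN n" "f \<in> NN n" "g \<in> NN n"
      using ch_1 unfolding One_nat_def by (elim leech_chains_SucE leech_chains_0E) auto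
    then have "((c, []), f, g) \<in> cells n (leech_chains n 0) leech_ob (leech_ob ch)"
      "((c + f + g, []), 0, 0) \<in> cells n (leech_chains n 0) leech_ob (leech_ob ch)"
      by (auto simp: cells_def leech_ob_Cons)
    then show ?thesis
      using leech_bd_1 ch(1) by blast
  qed
next
  fix \<beta> assume "\<beta> \<in> NN n"
  then have "((\<beta>, []), 0, 0) \<in> cells n (leech_chains n 0) leech_ob \<beta>"
    by (simp add: cells_def)
  then show "cells n (leech_chains n 0) leech_ob \<beta> \<noteq> {}"
    by blast
next
  fix \<beta> x y
  assume x: "x \<in> cells n (leech_chains n 0) leech_ob \<beta>" and y: "y \<in> cells n (leech_chains n 0) leech_ob \<beta>"
  \<comment> \<open>Two edges to the same terminal vertex, which cancels in the difference of their
    boundaries.\<close>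
  let ?w = "frag_of (leech_cone x) - frag_of (leech_cone y)"
  have "Poly_Mapping.keys ?w \<subseteq> cells n (leech_chains n 1) leech_ob \<beta>"
    using leech_cone_cells [OF x] leech_cone_cells [OF y] by (intro order_trans [OF keys_diff]) simp
  moreover have "nat_ext leech_bd ?w = frag_of x - frag_of y"
    by (simp add: nat_ext_diff leech_bd_contraction_0 [OF x] leech_bd_contraction_0 [OF y])
  ultimately show "\<exists>w. Poly_Mapping.keys w \<subseteq> cells n (leech_chains n 1) leech_ob \<beta>
      \<and> nat_ext leech_bd w = frag_of x - frag_of y"
    by blast
next
  fix \<beta> z k
  assume z: "Poly_Mapping.keys z \<subseteq> cells n (leech_chains n (Suc k)) leech_ob \<beta>" "nat_ext leech_bd z = 0"
  then show "\<exists>w. Poly_Mapping.keys w \<subseteq> cells n (leech_chains n (Suc (Suc k))) leech_ob \<beta> \<and> nat_ext leech_bd w = z"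
    using keys_leech_contraction [OF z(1)] leech_bd_contraction [OF z(1)] by (metis diff_zero leech_contraction_zero)
qed (auto intro: leech_ob_in_NN leech_bd_leech_bd dest: keys_leech_bd)

section \<open>The cubical complex is acyclic\<close>

text \<open>If \<open>i\<close> is the \<open>s\<close>-th smallest element of \<open>S\<close>,
  this is the sign of \<open>s - 1\<close>; counting smaller elements avoids positions in the
  computations with sets.\<close>

definition cube_sgn :: "nat \<Rightarrow> nat set \<Rightarrow> int" where
  "cube_sgn i S = (- 1) ^ card {l \<in> S. l < i}"

text \<open>A cell \<open>(S, f, g)\<close> is the unit cube with lowest corner \<open>f\<close>
  that extends in the directions \<open>S\<close>. Adding \<open>gen i\<close> to \<open>f\<close>
  gives its upper face in direction \<open>i\<close>, adding it to \<open>g\<close> gives the lower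
  one.\<close>

definition cube_bd :: "nat set \<Rightarrow> (nat set cell \<Rightarrow>\<^sub>0 int)" where
  "cube_bd S = (\<Sum>i\<in>S. frag_cmul (cube_sgn i S) (frag_of (S - {i}, gen i, 0) - frag_of (S - {i}, 0, gen i)))"

lemma frag_cmul_diff2: "frag_cmul c (a - b) = frag_cmul c a - frag_cmul c b"
  using frag_cmul_distrib2 [of c "a - b" b] by (simp add: algebra_simps)

lemma cube_sgn_square [simp]: "cube_sgn i S * cube_sgn i S = 1"
  by (simp add: cube_sgn_def flip: power_mult_distrib)

lemma cube_sgn_remove_self [simp]: "cube_sgn i (S - {i}) = cube_sgn i S"
proof -
  have "{l \<in> S - {i}. l < i} = {l \<in> S. l < i}" by auto
  then show ?thesis by (simp add: cube_sgn_def)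
qed

lemma cube_sgn_insert_self [simp]: "cube_sgn i (insert i S) = cube_sgn i S"
proof -
  have "{l \<in> insert i S. l < i} = {l \<in> S. l < i}" by auto
  then show ?thesis by (simp add: cube_sgn_def)
qed

lemma cube_sgn_remove:
  assumes "finite S" "i \<in> S" "i \<noteq> j"
  shows "cube_sgn j (S - {i}) = (if i < j then - cube_sgn j S else cube_sgn j S)"
proof (cases "i < j")
  case True
  have eq: "{l \<in> S. l < j} = insert i {l \<in> S - {i}. l < j}"
    using assms True by auto
  have "card {l \<in> S. l < j} = Suc (card {l \<in> S - {i}. l < j})"
    unfolding eq using assms by (subst card_insert_disjoint) auto
  then show ?thesis
    using True by (simp add: cube_sgn_def)
next
  case False
  then have "{l \<in> S - {i}. l < j} = {l \<in> S. l < j}"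
    using assms by auto
  then show ?thesis
    using False by (simp add: cube_sgn_def)
qed

text \<open>Exactly one of \<open>i\<close> and \<open>j\<close> is smaller than the other, so
  exactly one of the two signs changes upon removal.\<close>

lemma cube_sgn_swap:
  assumes "finite S" "i \<in> S" "j \<in> S" "i \<noteq> j"
  shows "cube_sgn i S * cube_sgn j (S - {i}) = - (cube_sgn j S * cube_sgn i (S - {j}))"
  using assms by (auto simp: cube_sgn_remove)

lemma cube_sgn_insert:
  assumes "finite S" "i \<in> S" "j \<notin> S"
  shows "cube_sgn j S * cube_sgn i (insert j S) = - (cube_sgn i S * cube_sgn j (S - {i}))"
proof -
  have "insert j S - {j} = S" "i \<noteq> j"
    using assms by auto
  then show ?thesis
    using cube_sgn_remove [of S i j] cube_sgn_remove [of "insert j S" j i] assms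
    by (auto split: if_splits)
qed

section \<open>Exponents and faces of unit cubes\<close>

lemma gen_in_NN [simp]: "i \<in> {1..n} \<Longrightarrow> gen i \<in> NN n"
  by (auto simp: gen_def ind_def NN_def)

lemma ind_in_NN: "S \<subseteq> {1..n} \<Longrightarrow> ind S \<in> NN n"
  by (auto simp: ind_def NN_def)

lemma ind_empty [simp]: "ind {} = 0"
  by (simp add: ind_def fun_eq_iff zero_fun_apply)

lemma ind_remove: "i \<in> S \<Longrightarrow> ind (S - {i}) + gen i = ind S"
  by (auto simp: ind_def gen_def fun_eq_iff plus_fun_apply)

lemma TnD: "S \<in> Tn n k \<Longrightarrow> S \<subseteq> {1..n} \<and> finite S \<and> card S = k"
  by (auto simp: Tn_def intro: finite_subset)

lemma cube_cells:
  assumes "S \<in> Tn n (Suc k)" "i \<in> S"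
  shows "(S - {i}, gen i, 0) \<in> cells n (Tn n k) ind (ind S)"
    and "(S - {i}, 0, gen i) \<in> cells n (Tn n k) ind (ind S)"
  using assms TnD [OF assms(1)] by (auto simp: cells_def Tn_def ind_remove subset_eq)

lemma keys_cube_bd:
  assumes "S \<in> Tn n (Suc k)"
  shows "Poly_Mapping.keys (cube_bd S) \<subseteq> cells n (Tn n k) ind (ind S)"
  unfolding cube_bd_def
proof (rule order_trans [OF keys_sum UN_least])
  fix i assume "i \<in> S"
  then show "Poly_Mapping.keys (frag_cmul (cube_sgn i S) (frag_of (S - {i}, gen i, 0) - frag_of (S - {i}, 0, gen i)))
      \<subseteq> cells n (Tn n k) ind (ind S)"
    using cube_cells [OF assms] by (intro order_trans [OF keys_cmul order_trans [OF keys_diff]]) auto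
qed

lemma nat_ext_cube_bd:
  assumes "finite S"
  shows "nat_ext cube_bd (frag_of (S, f, g)) = (\<Sum>i\<in>S. frag_cmul (cube_sgn i S)
      (frag_of (S - {i}, f + gen i, g) - frag_of (S - {i}, f, g + gen i)))"
  using assms by (simp add: cube_bd_def shift_sum shift_cmul shift_diff)

text \<open>The double boundary is a sum over ordered pairs of directions in which the faces are
  symmetric and the signs antisymmetric.\<close>

lemma cube_bd_cube_bd:
  assumes S: "finite S"
  shows "nat_ext cube_bd (cube_bd S) = 0"
proof -
  \<comment> \<open>The four faces of codimension 2 orthogonal to the directions \<open>i\<close>
    and \<open>l\<close>, with the signs of upper and lower sides.\<close>
  define E where "E i l = frag_of (S - {i} - {l}, gen i + gen l, 0) - frag_of (S - {i} - {l}, gen i, gen l)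
      - frag_of (S - {i} - {l}, gen l, gen i) + frag_of (S - {i} - {l}, 0, gen i + gen l)" for i l
  have E_swap: "E i l = E l i" for i l
    by (simp add: E_def add.commute Diff_insert2 [symmetric] insert_commute Diff_insert [symmetric])
  define T where "T i l = frag_cmul (cube_sgn i S * cube_sgn l (S - {i})) (E i l)" for i l
  define X where "X = (\<Sum>i\<in>S. \<Sum>l\<in>S - {i}. T i l)"
  have "nat_ext cube_bd (cube_bd S) = (\<Sum>i\<in>S. frag_cmul (cube_sgn i S)
      (nat_ext cube_bd (frag_of (S - {i}, gen i, 0)) - nat_ext cube_bd (frag_of (S - {i}, 0, gen i))))"
    using S by (simp add: cube_bd_def [of S] nat_ext_sum nat_ext_cmul nat_ext_diff del: nat_ext_of)
  also have "\<dots> = X"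
    unfolding X_def
  proof (rule sum.cong)
    fix i assume "i \<in> S"
    have "nat_ext cube_bd (frag_of (S - {i}, gen i, 0)) - nat_ext cube_bd (frag_of (S - {i}, 0, gen i))
        = (\<Sum>l\<in>S - {i}. frag_cmul (cube_sgn l (S - {i})) (E i l))"
      using S by (simp add: nat_ext_cube_bd E_def algebra_simps frag_cmul_distrib2 frag_cmul_diff_distrib
          frag_cmul_diff2 flip: sum_subtractf del: nat_ext_of)
    then show "frag_cmul (cube_sgn i S)
        (nat_ext cube_bd (frag_of (S - {i}, gen i, 0)) - nat_ext cube_bd (frag_of (S - {i}, 0, gen i)))
      = (\<Sum>l\<in>S - {i}. T i l)"
      by (simp add: frag_cmul_sum T_def)
  qed auto
  finally have eq: "nat_ext cube_bd (cube_bd S) = X" .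
  have "{l \<in> S. l \<noteq> i} = S - {i}" "{l \<in> S. i \<noteq> l} = S - {i}" for i
    by auto
  then have "X = (\<Sum>l\<in>S. \<Sum>i\<in>S - {l}. T i l)"
    unfolding X_def using sum.swap_restrict [OF S S, of T "\<lambda>i l. l \<noteq> i"] by simp
  also have "\<dots> = (\<Sum>l\<in>S. \<Sum>i\<in>S - {l}. - T l i)"
  proof (intro sum.cong refl)
    fix l i assume "l \<in> S" "i \<in> S - {l}"
    then have "cube_sgn i S * cube_sgn l (S - {i}) = - (cube_sgn l S * cube_sgn i (S - {l}))"
      using S by (intro cube_sgn_swap) auto
    then show "T i l = - T l i"
      using E_swap [of i l] by (simp add: T_def)
  qed
  also have "\<dots> = - X"
    by (simp add: X_def sum_negf)
  \<comment> \<open>Antisymmetry gives only \<open>2 X = 0\<close>; the chains form a torsion-free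
    group.\<close>
  finally have "X + X = 0"
    by (metis add.right_inverse)
  then have "frag_cmul 2 X = 0"
    using frag_cmul_distrib [of 1 1 X] by simp
  then show ?thesis
    by (simp add: eq)
qed

text \<open>Contraction of the grid in direction \<open>j\<close> onto the face where the \<open>j\<close>-th exponent of the first
  factor vanishes: a cell is swept along the \<open>j\<close>-th axis.\<close>

definition cube_sweep :: "nat \<Rightarrow> nat set cell \<Rightarrow> (nat set cell \<Rightarrow>\<^sub>0 int)" where
  "cube_sweep j = (\<lambda>(S, f, g). if j \<in> S then 0 else
    frag_cmul (cube_sgn j S) (\<Sum>t<f j. frag_of (insert j S, f(j := t), g(j := f j + g j - 1 - t))))"

text \<open>The exponent removed from \<open>f\<close> is moved to \<open>g\<close>, which keeps the
  cell over the same object. Cells extending in direction \<open>j\<close> are flattened by the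
  projection and go to zero.\<close>

definition cube_proj :: "nat \<Rightarrow> nat set cell \<Rightarrow> (nat set cell \<Rightarrow>\<^sub>0 int)" where
  "cube_proj j = (\<lambda>(S, f, g). if j \<in> S then 0 else frag_of (S, f(j := 0), g(j := f j + g j)))"

text \<open>The prism identity: the ends of the prism swept out by a cell telescope to the cell
  minus its projection, and its sides cancel against the prisms over the faces.\<close>

lemma cube_sweep_cell:
  assumes S: "finite S"
  shows "nat_ext cube_bd (cube_sweep j (S, f, g)) + frag_extend (cube_sweep j) (nat_ext cube_bd (frag_of (S, f, g)))
    = frag_of (S, f, g) - cube_proj j (S, f, g)"
proof (cases "j \<in> S")
  case True
  have gen_upd: "(f + gen j)(j := t) = f(j := t)" "(g + gen j)(j := t) = g(j := t)" for t
    by (auto simp: fun_eq_iff gen_def ind_def plus_fun_apply)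
  have gen_j: "(f + gen j) j = Suc (f j)" "(g + gen j) j = Suc (g j)"
    by (auto simp: gen_def ind_def plus_fun_apply)
  have "frag_extend (cube_sweep j) (nat_ext cube_bd (frag_of (S, f, g)))
      = (\<Sum>i\<in>S. frag_cmul (cube_sgn i S) (cube_sweep j (S - {i}, f + gen i, g) - cube_sweep j (S - {i}, f, g + gen i)))"
    using S by (simp add: nat_ext_cube_bd frag_extend_sum o_def frag_extend_cmul frag_extend_diff del: nat_ext_of)
  also have "\<dots> = (\<Sum>i\<in>{j}. frag_cmul (cube_sgn i S) (cube_sweep j (S - {i}, f + gen i, g) - cube_sweep j (S - {i}, f, g + gen i)))"
    using S True by (intro sum.mono_neutral_right) (auto simp: cube_sweep_def)
  \<comment> \<open>The sweep of the upper \<open>j\<close>-face runs over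
    \<open>t \<le> f j\<close> and that of the lower one over \<open>t < f j\<close>, through the
    same cells; what remains is the cell at \<open>t = f j\<close>, which is the given one.\<close>
  also have "\<dots> = frag_of (S, f, g)"
    using True by (simp add: cube_sweep_def gen_upd gen_j insert_absorb frag_cmul_distrib2)
  finally show ?thesis
    using True by (simp add: cube_sweep_def cube_proj_def)
next
  case False
  let ?f = "\<lambda>t. f(j := t)" and ?g = "\<lambda>t. g(j := f j + g j - 1 - t)"
  \<comment> \<open>\<open>v t\<close> is the copy of the cell at height \<open>t\<close>, and
    \<open>W i t\<close> is the upper minus the lower face in direction \<open>i\<close> of the
    prism between heights \<open>t\<close> and \<open>t + 1\<close>.\<close>
  define v where "v t = frag_of (S, f(j := t), g(j := f j + g j - t))" for t
  define W where "W i t = frag_of (insert j (S - {i}), ?f t + gen i, ?g t) - frag_of (insert j (S - {i}), ?f t, ?g t + gen i)" for i t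
  have cell: "nat_ext cube_bd (frag_of (insert j S, ?f t, ?g t))
      = frag_cmul (cube_sgn j S) (v (Suc t) - v t) + (\<Sum>i\<in>S. frag_cmul (cube_sgn i (insert j S)) (W i t))"
    if t: "t < f j" for t
  proof -
    have "?f t + gen j = f(j := Suc t)" "?g t = g(j := f j + g j - Suc t)" "?g t + gen j = g(j := f j + g j - t)"
      using t by (auto simp: fun_eq_iff gen_def ind_def plus_fun_apply)
    moreover have "insert j S - {i} = insert j (S - {i})" if "i \<in> S" for i
      using that False by auto
    ultimately show ?thesis
      using S False by (simp add: nat_ext_cube_bd v_def W_def del: nat_ext_of cong: sum.cong)
  qed
  have "nat_ext cube_bd (cube_sweep j (S, f, g)) = frag_cmul (cube_sgn j S)
      (\<Sum>t<f j. frag_cmul (cube_sgn j S) (v (Suc t) - v t) + (\<Sum>i\<in>S. frag_cmul (cube_sgn i (insert j S)) (W i t)))"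
    using False cell by (simp add: cube_sweep_def nat_ext_cmul nat_ext_sum del: nat_ext_of)
  also have "\<dots> = (\<Sum>t<f j. v (Suc t) - v t)
      + (\<Sum>t<f j. \<Sum>i\<in>S. frag_cmul (cube_sgn j S * cube_sgn i (insert j S)) (W i t))"
    by (simp add: frag_cmul_sum frag_cmul_distrib2 sum.distrib)
  also have "(\<Sum>t<f j. v (Suc t) - v t) = v (f j) - v 0"
    by (rule sum_lessThan_telescope)
  also have "\<dots> = frag_of (S, f, g) - cube_proj j (S, f, g)"
    using False by (simp add: v_def cube_proj_def)
  finally have 1: "nat_ext cube_bd (cube_sweep j (S, f, g)) = frag_of (S, f, g) - cube_proj j (S, f, g)
      + (\<Sum>t<f j. \<Sum>i\<in>S. frag_cmul (cube_sgn j S * cube_sgn i (insert j S)) (W i t))" .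
  have sweep: "cube_sweep j (S - {i}, f + gen i, g) - cube_sweep j (S - {i}, f, g + gen i)
      = (\<Sum>t<f j. frag_cmul (cube_sgn j (S - {i})) (W i t))" if i: "i \<in> S" for i
  proof -
    have "(f + gen i) j = f j" "(g + gen i) j = g j"
      "(f + gen i)(j := t) = f(j := t) + gen i" "(g + gen i)(j := t) = g(j := t) + gen i" for t
      using i False by (auto simp: fun_eq_iff gen_def ind_def plus_fun_apply)
    then show ?thesis
      using False by (simp add: cube_sweep_def W_def frag_cmul_sum frag_cmul_diff2 sum_subtractf)
  qed
  have "frag_extend (cube_sweep j) (nat_ext cube_bd (frag_of (S, f, g)))
      = (\<Sum>i\<in>S. frag_cmul (cube_sgn i S) (cube_sweep j (S - {i}, f + gen i, g) - cube_sweep j (S - {i}, f, g + gen i)))"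
    using S by (simp add: nat_ext_cube_bd frag_extend_sum o_def frag_extend_cmul frag_extend_diff del: nat_ext_of)
  also have "\<dots> = (\<Sum>i\<in>S. \<Sum>t<f j. frag_cmul (cube_sgn i S * cube_sgn j (S - {i})) (W i t))"
    by (simp add: sweep frag_cmul_sum)
  also have "\<dots> = (\<Sum>t<f j. \<Sum>i\<in>S. frag_cmul (cube_sgn i S * cube_sgn j (S - {i})) (W i t))"
    by (rule sum.swap)
  \<comment> \<open>The prisms over the faces consist of the same cells as the sides of the prism,
    and \<open>cube_sgn_insert\<close> makes their signs opposite.\<close>
  also have "\<dots> = - (\<Sum>t<f j. \<Sum>i\<in>S. frag_cmul (cube_sgn j S * cube_sgn i (insert j S)) (W i t))"
    using S False by (simp add: cube_sgn_insert flip: sum_negf)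
  finally show ?thesis
    using 1 by simp
qed

lemma cube_sweep_cells:
  assumes "x \<in> cells n (Tn n k) ind \<beta>" "j \<in> {1..n}"
  shows "Poly_Mapping.keys (cube_sweep j x) \<subseteq> cells n (Tn n (Suc k)) ind \<beta>"
proof -
  obtain S f g where x: "x = (S, f, g)" "S \<in> Tn n k" "f \<in> NN n" "g \<in> NN n" "ind S + f + g = \<beta>"
    using assms by (auto simp: cells_def)
  \<comment> \<open>The new edge in direction \<open>j\<close> uses one unit of the total
    \<open>f j + g j\<close>, so \<open>f j + g j - 1 - t\<close> is left for the last factor;
    \<open>t < f j\<close> keeps the subtraction exact.\<close>
  have "(insert j S, f(j := t), g(j := f j + g j - 1 - t)) \<in> cells n (Tn n (Suc k)) ind \<beta>"
    if "j \<notin> S" "t < f j" for t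
  proof -
    have "insert j S \<in> Tn n (Suc k)"
      using x(2) that assms(2) TnD [OF x(2)] by (auto simp: Tn_def)
    moreover have "ind (insert j S) + f(j := t) + g(j := f j + g j - 1 - t) = \<beta>"
      using that by (auto simp: fun_eq_iff ind_def plus_fun_apply simp flip: x(5))
    ultimately show ?thesis
      using x(3,4) assms(2) by (auto simp: cells_def NN_def)
  qed
  then have "Poly_Mapping.keys (\<Sum>t<f j. frag_of (insert j S, f(j := t), g(j := f j + g j - 1 - t)))
      \<subseteq> cells n (Tn n (Suc k)) ind \<beta>" if "j \<notin> S"
    using that by (intro order_trans [OF keys_sum]) auto
  then show ?thesis
    using order_trans [OF keys_cmul] by (auto simp: x(1) cube_sweep_def)
qed

text \<open>The set of directions is preserved, so directions eliminated by earlier projections stay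
  eliminated.\<close>

lemma cube_proj_cells:
  assumes "x \<in> cells n (Tn n k) ind \<beta>" "j \<in> {1..n}"
  shows "Poly_Mapping.keys (cube_proj j x) \<subseteq> {y \<in> cells n (Tn n k) ind \<beta>. j \<notin> fst y \<and> fst y = fst x}"
proof -
  obtain S f g where x: "x = (S, f, g)" "S \<in> Tn n k" "f \<in> NN n" "g \<in> NN n" "ind S + f + g = \<beta>"
    using assms by (auto simp: cells_def)
  have "ind S + f(j := 0) + g(j := f j + g j) = \<beta>"
    by (auto simp: fun_eq_iff ind_def plus_fun_apply simp flip: x(5))
  then have "(S, f(j := 0), g(j := f j + g j)) \<in> cells n (Tn n k) ind \<beta>"
    using x assms(2) by (auto simp: cells_def NN_def)
  then show ?thesis
    by (auto simp: x(1) cube_proj_def)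
qed

lemma cube_sweep_homotopy:
  assumes "Poly_Mapping.keys z \<subseteq> cells n (Tn n k) ind \<beta>"
  shows "nat_ext cube_bd (frag_extend (cube_sweep j) z) + frag_extend (cube_sweep j) (nat_ext cube_bd z)
    = z - frag_extend (cube_proj j) z"
  using assms
proof (induction z rule: frag_induction)
  case (one x)
  obtain S f g where "x = (S, f, g)" "finite S"
    using one TnD by (auto simp: cells_def)
  then show ?case
    using cube_sweep_cell by simp
next
  case (diff a b)
  then show ?case
    by (simp add: frag_extend_diff nat_ext_diff algebra_simps)
qed auto

text \<open>Sweeping in the directions up to \<open>m\<close> one after the other changes the cycle
  by boundaries and removes all cells that extend in one of these directions. For
  \<open>m = n\<close> and positive degree nothing is left.\<close>

lemma cube_cycle_retract:
  assumes z: "Poly_Mapping.keys z \<subseteq> cells n (Tn n k) ind \<beta>" "nat_ext cube_bd z = 0" and "m \<le> n"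
  shows "\<exists>w z'. Poly_Mapping.keys w \<subseteq> cells n (Tn n (Suc k)) ind \<beta> \<and> nat_ext cube_bd w = z - z' \<and>
    Poly_Mapping.keys z' \<subseteq> {x \<in> cells n (Tn n k) ind \<beta>. fst x \<inter> {1..m} = {}}"
  using \<open>m \<le> n\<close>
proof (induction m)
  case 0
  then show ?case
    using z by (intro exI [of _ 0] exI [of _ z]) auto
next
  case (Suc m)
  then obtain w z' where w: "Poly_Mapping.keys w \<subseteq> cells n (Tn n (Suc k)) ind \<beta>" "nat_ext cube_bd w = z - z'"
    and z': "Poly_Mapping.keys z' \<subseteq> {x \<in> cells n (Tn n k) ind \<beta>. fst x \<inter> {1..m} = {}}"
    by auto
  have z'_cells: "Poly_Mapping.keys z' \<subseteq> cells n (Tn n k) ind \<beta>"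
    using z' by blast
  \<comment> \<open>The remaining chain differs from the cycle \<open>z\<close> by a boundary and is
    a cycle itself, so the sweep of its boundary drops out of the homotopy identity.\<close>
  have "nat_ext cube_bd (nat_ext cube_bd w) = nat_ext (\<lambda>S. 0) w"
    unfolding nat_ext_nat_ext using w(1) by (rule nat_ext_cong) (auto dest: TnD intro: cube_bd_cube_bd)
  also have "\<dots> = 0"
    by (simp add: nat_ext_def frag_extend_eq_0 split_def)
  finally have "nat_ext cube_bd z' = 0"
    using w(2) z(2) by (simp add: nat_ext_diff)
  then have sweep: "nat_ext cube_bd (frag_extend (cube_sweep (Suc m)) z') = z' - frag_extend (cube_proj (Suc m)) z'"
    using cube_sweep_homotopy [OF z'_cells, of "Suc m"] by simp
  have j: "Suc m \<in> {1..n}"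
    using Suc.prems by auto
  let ?w = "w + frag_extend (cube_sweep (Suc m)) z'"
  have "Poly_Mapping.keys (frag_extend (cube_sweep (Suc m)) z') \<subseteq> cells n (Tn n (Suc k)) ind \<beta>"
    using z'_cells cube_sweep_cells [OF _ j] by (intro order_trans [OF keys_frag_extend] UN_least) blast
  then have "Poly_Mapping.keys ?w \<subseteq> cells n (Tn n (Suc k)) ind \<beta>"
    using w(1) by (intro order_trans [OF keys_add] Un_least)
  moreover have "nat_ext cube_bd ?w = z - frag_extend (cube_proj (Suc m)) z'"
    by (simp add: nat_ext_add w(2) sweep)
  moreover have "Poly_Mapping.keys (frag_extend (cube_proj (Suc m)) z')
      \<subseteq> {x \<in> cells n (Tn n k) ind \<beta>. fst x \<inter> {1..Suc m} = {}}"
  proof (intro order_trans [OF keys_frag_extend] UN_least)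
    fix x assume "x \<in> Poly_Mapping.keys z'"
    then have "x \<in> cells n (Tn n k) ind \<beta>" "fst x \<inter> {1..m} = {}"
      using z' by auto
    then show "Poly_Mapping.keys (cube_proj (Suc m) x) \<subseteq> {x \<in> cells n (Tn n k) ind \<beta>. fst x \<inter> {1..Suc m} = {}}"
      using cube_proj_cells [OF _ j, of x k \<beta>] by (auto simp: atLeastAtMostSuc_conv)
  qed
  ultimately show ?case
    by (intro exI [of _ ?w] exI [of _ "frag_extend (cube_proj (Suc m)) z'"] conjI)
qed

text \<open>Vertices have no directions to eliminate, so progress is measured by vanishing
  exponents: the vertex is moved along one axis after the other towards the corner \<open>0\<close>
  of the box.\<close>

lemma cube_vertex_retract:
  assumes x: "x \<in> cells n (Tn n 0) ind \<beta>" and "m \<le> n"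
  shows "\<exists>w f g. Poly_Mapping.keys w \<subseteq> cells n (Tn n 1) ind \<beta> \<and> nat_ext cube_bd w = frag_of x - frag_of ({}, f, g) \<and>
    ({}, f, g) \<in> cells n (Tn n 0) ind \<beta> \<and> (\<forall>j \<in> {1..m}. f j = 0)"
  using \<open>m \<le> n\<close>
proof (induction m)
  case 0
  obtain f g where "x = ({}, f, g)"
    using x TnD by (fastforce simp: cells_def)
  then show ?case
    using x by (intro exI [of _ 0] exI [of _ f] exI [of _ g]) auto
next
  case (Suc m)
  then obtain w f g where w: "Poly_Mapping.keys w \<subseteq> cells n (Tn n 1) ind \<beta>"
      "nat_ext cube_bd w = frag_of x - frag_of ({}, f, g)"
    and y: "({}, f, g) \<in> cells n (Tn n 0) ind \<beta>" and f: "\<forall>j \<in> {1..m}. f j = 0"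
    by auto
  have j: "Suc m \<in> {1..n}"
    using Suc.prems by auto
  let ?y = "({}, f(Suc m := 0), g(Suc m := f (Suc m) + g (Suc m)))"
  let ?w = "w + cube_sweep (Suc m) ({}, f, g)"
  have "Poly_Mapping.keys ?w \<subseteq> cells n (Tn n 1) ind \<beta>"
    using w(1) cube_sweep_cells [OF y j] by (intro order_trans [OF keys_add] Un_least) auto
  moreover have "nat_ext cube_bd (cube_sweep (Suc m) ({}, f, g)) = frag_of ({}, f, g) - frag_of ?y"
    using cube_sweep_cell [of "{}" "Suc m" f g] by (simp add: cube_bd_def cube_proj_def)
  then have "nat_ext cube_bd ?w = frag_of x - frag_of ?y"
    by (simp add: nat_ext_add w(2))
  moreover have "?y \<in> cells n (Tn n 0) ind \<beta>"
    using cube_proj_cells [OF y j] by (simp add: cube_proj_def)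
  moreover have "\<forall>i \<in> {1..Suc m}. (f(Suc m := 0)) i = 0"
    using f by auto
  ultimately show ?case
    by - (rule exI [of _ ?w], rule exI [of _ "f(Suc m := 0)"],
        rule exI [of _ "g(Suc m := f (Suc m) + g (Suc m))"], intro conjI)
qed

lemma cube_vertex_boundary:
  assumes "x \<in> cells n (Tn n 0) ind \<beta>"
  shows "\<exists>w. Poly_Mapping.keys w \<subseteq> cells n (Tn n 1) ind \<beta> \<and> nat_ext cube_bd w = frag_of x - frag_of ({}, 0, \<beta>)"
proof -
  obtain w f g where w: "Poly_Mapping.keys w \<subseteq> cells n (Tn n 1) ind \<beta>"
      "nat_ext cube_bd w = frag_of x - frag_of ({}, f, g)"
    and y: "({}, f, g) \<in> cells n (Tn n 0) ind \<beta>" and f: "\<forall>j \<in> {1..n}. f j = 0"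
    using cube_vertex_retract [OF assms order_refl] by (elim exE conjE) (rule that)
  have "f j = 0" for j
  proof -
    have "j \<in> {1..n} \<or> j = 0 \<or> n < j"
      by auto
    then show ?thesis
      using y f by (auto simp: cells_def NN_def)
  qed
  then have "f = 0"
    by (simp add: fun_eq_iff zero_fun_apply)
  moreover have "g = \<beta>"
    using y \<open>f = 0\<close> by (simp add: cells_def)
  ultimately show ?thesis
    using w by blast
qed

lemma acyclic_cube: "acyclic_complex n (Tn n) ind cube_bd"
proof
  show "ind S \<in> NN n" if "S \<in> Tn n k" for S k
    using TnD [OF that] ind_in_NN by blast
  show "nat_ext cube_bd (cube_bd S) = 0" if "S \<in> Tn n (Suc (Suc k))" for S k
    using TnD [OF that] cube_bd_cube_bd by blast
  show "\<exists>x \<in> cells n (Tn n 0) ind (ind S). \<exists>y \<in> cells n (Tn n 0) ind (ind S). cube_bd S = frag_of x - frag_of y"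
    if S: "S \<in> Tn n 1" for S
  proof -
    obtain i where i: "S = {i}"
      using TnD [OF S] card_1_singletonE by blast
    have "{l \<in> {i}. l < i} = {}"
      by auto
    then have "cube_sgn i {i} = 1"
      unfolding cube_sgn_def by (simp only: card.empty power_0)
    then have "cube_bd S = frag_of (S - {i}, gen i, 0) - frag_of (S - {i}, 0, gen i)"
      by (simp add: cube_bd_def i)
    then show ?thesis
      using cube_cells [of S n 0 i] S i by auto
  qed
  show "cells n (Tn n 0) ind \<beta> \<noteq> {}" if "\<beta> \<in> NN n" for \<beta>
  proof -
    have "({}, 0, \<beta>) \<in> cells n (Tn n 0) ind \<beta>"
      using that by (simp add: cells_def Tn_def)
    then show ?thesis
      by blast
  qed
next
  fix \<beta> x y
  assume x: "x \<in> cells n (Tn n 0) ind \<beta>" and y: "y \<in> cells n (Tn n 0) ind \<beta>"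
  obtain w where w: "Poly_Mapping.keys w \<subseteq> cells n (Tn n 1) ind \<beta>"
      "nat_ext cube_bd w = frag_of x - frag_of ({}, 0, \<beta>)"
    using cube_vertex_boundary [OF x] by (elim exE conjE) (rule that)
  obtain w' where w': "Poly_Mapping.keys w' \<subseteq> cells n (Tn n 1) ind \<beta>"
      "nat_ext cube_bd w' = frag_of y - frag_of ({}, 0, \<beta>)"
    using cube_vertex_boundary [OF y] by (elim exE conjE) (rule that)
  have "Poly_Mapping.keys (w - w') \<subseteq> cells n (Tn n 1) ind \<beta>"
    using w(1) w'(1) by (intro order_trans [OF keys_diff] Un_least)
  moreover have "nat_ext cube_bd (w - w') = frag_of x - frag_of y"
    by (simp add: nat_ext_diff w(2) w'(2))
  ultimately show "\<exists>w. Poly_Mapping.keys w \<subseteq> cells n (Tn n 1) ind \<beta> \<and> nat_ext cube_bd w = frag_of x - frag_of y"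
    by blast
next
  fix \<beta> z k
  assume z: "Poly_Mapping.keys z \<subseteq> cells n (Tn n (Suc k)) ind \<beta>" "nat_ext cube_bd z = 0"
  obtain w z' where w: "Poly_Mapping.keys w \<subseteq> cells n (Tn n (Suc (Suc k))) ind \<beta>" "nat_ext cube_bd w = z - z'"
    and z': "Poly_Mapping.keys z' \<subseteq> {x \<in> cells n (Tn n (Suc k)) ind \<beta>. fst x \<inter> {1..n} = {}}"
    using cube_cycle_retract [OF z order_refl] by (elim exE conjE) (rule that)
  \<comment> \<open>A cube of positive dimension extends in some direction from
    \<open>{1..n}\<close>.\<close>
  have empty: "{x \<in> cells n (Tn n (Suc k)) ind \<beta>. fst x \<inter> {1..n} = {}} = {}"
    by (auto simp: cells_def Tn_def Int_absorb2)
  have "z' = 0"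
    using z' unfolding empty by simp
  then show "\<exists>w. Poly_Mapping.keys w \<subseteq> cells n (Tn n (Suc (Suc k))) ind \<beta> \<and> nat_ext cube_bd w = z"
    using w by auto
qed (auto dest: keys_cube_bd)

section \<open>Positions of directions, and the signs of the cubical differential\<close>

lemma cube_idx_bij: "finite S \<Longrightarrow> bij_betw (cube_idx S) {1..card S} S"
proof -
  assume S: "finite S"
  have "bij_betw (\<lambda>s. s - 1) {1..card S} {..<card S}"
    by (rule bij_betw_byWitness [where f' = Suc]) auto
  moreover have "bij_betw ((!) (sorted_list_of_set S)) {..<card S} S"
    using S by (intro bij_betw_nth) auto
  ultimately show ?thesis
    using bij_betw_trans by (fastforce simp: cube_idx_def [abs_def] o_def)
qed

text \<open>Translates the position of a direction, counted from 1, into the number of smaller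
  directions that defines \<open>cube_sgn\<close>.\<close>

lemma card_below_cube_idx:
  assumes S: "finite S" and s: "s \<in> {1..card S}"
  shows "card {l \<in> S. l < cube_idx S s} = s - 1"
proof -
  let ?xs = "sorted_list_of_set S"
  have len: "length ?xs = card S" and set: "set ?xs = S" and sorted: "sorted_wrt (<) ?xs"
    using S by auto
  have lt: "?xs ! i < ?xs ! j \<longleftrightarrow> i < j" if "i < card S" "j < card S" for i j
    using that len sorted_wrt_nth_less [OF sorted] by (metis not_less_iff_gr_or_eq)
  have "{l \<in> S. l < cube_idx S s} = (!) ?xs ` {..<s - 1}"
  proof (intro subset_antisym subsetI)
    fix l assume "l \<in> {l \<in> S. l < cube_idx S s}"
    then obtain i where "i < card S" "l = ?xs ! i" "?xs ! i < ?xs ! (s - 1)"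
      using set len by (metis (no_types, lifting) cube_idx_def in_set_conv_nth mem_Collect_eq)
    then show "l \<in> (!) ?xs ` {..<s - 1}"
      using lt s by auto
  next
    fix l assume "l \<in> (!) ?xs ` {..<s - 1}"
    then obtain i where i: "i < s - 1" "l = ?xs ! i"
      by auto
    then have "i < card S"
      using s by auto
    then show "l \<in> {l \<in> S. l < cube_idx S s}"
      using i lt [of i "s - 1"] s set len nth_mem [of i ?xs] by (auto simp: cube_idx_def)
  qed
  moreover have "inj_on ((!) ?xs) {..<s - 1}"
    using s len by (intro inj_on_nth) auto
  ultimately show ?thesis
    by (simp add: card_image)
qed

text \<open>The boolean is the superscript of the face: \<open>False\<close> stands for 0, where the
  deleted generator becomes the first component of the morphism, and \<open>True\<close> for 1,
  where it becomes the second.\<close>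

definition cube_fst :: "nat \<times> bool \<Rightarrow> nat set \<Rightarrow> nat \<Rightarrow> nat" where
  "cube_fst se S = (if snd se then 0 else gen (cube_idx S (fst se)))"

definition cube_snd :: "nat \<times> bool \<Rightarrow> nat set \<Rightarrow> nat \<Rightarrow> nat" where
  "cube_snd se S = (if snd se then gen (cube_idx S (fst se)) else 0)"

text \<open>Position \<open>s\<close> has \<open>s - 1\<close> smaller directions, so
  \<open>cube_sgn\<close> is minus the sign of \<open>s\<close>. This is compensated by the opposite
  order of the two faces: \<open>cube_bd\<close> takes superscript 0 minus superscript 1.\<close>

lemma cube_bd_eq_face_sum:
  assumes "S \<in> Tn n k"
  shows "cube_bd S = (\<Sum>se\<in>{1..k} \<times> UNIV.
    frag_cmul (cube_sign se) (frag_of (cube_face se S, cube_fst se S, cube_snd se S)))"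
proof -
  have S: "finite S" "card S = k"
    using TnD [OF assms] by auto
  have sgn: "cube_sgn (cube_idx S s) S = - ((- 1) ^ s)" if "s \<in> {1..k}" for s
  proof -
    have "s = Suc (card {l \<in> S. l < cube_idx S s})"
      using card_below_cube_idx [OF S(1)] that S(2) by simp
    then show ?thesis
      unfolding cube_sgn_def by (metis mult_minus1 power_Suc minus_minus)
  qed
  have "cube_bd S = (\<Sum>s\<in>{1..k}. frag_cmul (cube_sgn (cube_idx S s) S)
      (frag_of (S - {cube_idx S s}, gen (cube_idx S s), 0) - frag_of (S - {cube_idx S s}, 0, gen (cube_idx S s))))"
    unfolding cube_bd_def using cube_idx_bij [OF S(1)] S(2) by (intro sum.reindex_bij_betw [symmetric]) simp
  also have "\<dots> = (\<Sum>s\<in>{1..k}. \<Sum>e\<in>UNIV.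
      frag_cmul (cube_sign (s, e)) (frag_of (cube_face (s, e) S, cube_fst (s, e) S, cube_snd (s, e) S)))"
  proof (rule sum.cong)
    fix s assume s: "s \<in> {1..k}"
    show "frag_cmul (cube_sgn (cube_idx S s) S)
        (frag_of (S - {cube_idx S s}, gen (cube_idx S s), 0) - frag_of (S - {cube_idx S s}, 0, gen (cube_idx S s)))
      = (\<Sum>e\<in>UNIV. frag_cmul (cube_sign (s, e)) (frag_of (cube_face (s, e) S, cube_fst (s, e) S, cube_snd (s, e) S)))"
      by (simp add: sgn [OF s] UNIV_bool cube_sign_def cube_face_def cube_fst_def cube_snd_def frag_cmul_diff2)
  qed auto
  also have "\<dots> = (\<Sum>se\<in>{1..k} \<times> UNIV.
      frag_cmul (cube_sign se) (frag_of (cube_face se S, cube_fst se S, cube_snd se S)))"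
    by (simp add: sum.cartesian_product split_def)
  finally show ?thesis .
qed

lemma cube_face_cells:
  assumes "S \<in> Tn n (Suc k)" "se \<in> {1..Suc k} \<times> UNIV"
  shows "(cube_face se S, cube_fst se S, cube_snd se S) \<in> cells n (Tn n k) ind (ind S)"
proof -
  have "cube_idx S (fst se) \<in> S"
    using cube_idx_bij [of S] TnD [OF assms(1)] assms(2) by (auto simp: bij_betw_def)
  then show ?thesis
    using cube_cells [OF assms(1)] by (auto simp: cube_face_def cube_fst_def cube_snd_def)
qed

section \<open>Identification of the two differentials\<close>

context natural_system
begin

lemma leech_complex_eq: "leech_complex n FG k = chain_group (leech_chains n k) leech_ob"
  by (simp add: leech_complex_def chain_group_def leech_ob_def)

lemma leech_diff_eq_tensor:
  assumes y: "y \<in> carrier (leech_complex n FG (Suc k))"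
  shows "leech_diff n FG Fm (Suc k) y = tensor (leech_chains n (Suc k)) (leech_chains n k) leech_ob leech_bd y"
proof -
  let ?f = "\<lambda>j ch. if j = 0 then fst (snd ch ! 0) else 0" and ?g = "\<lambda>j ch. if j = 0 then snd (snd ch ! 0) else 0"
  have "face_sum (\<lambda>ch. FG (leech_ob ch)) (leech_chains n (Suc k)) (leech_chains n k) {0..Suc k}
      (leech_face (Suc k)) (leech_coef Fm) (\<lambda>i. (- 1) ^ i) y
    = tensor (leech_chains n (Suc k)) (leech_chains n k) leech_ob leech_bd y"
  proof (rule face_sum_eq_tensor [where f = ?f and g = ?g])
    fix ch assume ch: "ch \<in> leech_chains n (Suc k)"
    then have "length (snd ch) = Suc k"
      by (auto simp: leech_chains_def)
    then show "leech_bd ch = (\<Sum>j\<in>{0..Suc k}. frag_cmul ((- 1) ^ j) (frag_of (leech_face (Suc k) j ch, ?f j ch, ?g j ch)))"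
      by (auto simp: leech_bd_def leech_cell_def)
    show cell: "(leech_face (Suc k) j ch, ?f j ch, ?g j ch) \<in> cells n (leech_chains n k) leech_ob (leech_ob ch)"
      if "j \<in> {0..Suc k}" for j
      using leech_cell_cells [OF ch, of j] that by (simp add: leech_cell_def)
    show "leech_coef Fm j ch x = Fm (leech_ob (leech_face (Suc k) j ch)) (?f j ch) (?g j ch) x"
      if j: "j \<in> {0..Suc k}" and x: "x \<in> carrier (FG (leech_ob ch))" for j x
    proof (cases "j = 0")
      case True
      obtain c f g ms where "ch = (c, (f, g) # ms)"
        using ch by (rule leech_chains_SucE)
      then show ?thesis
        using True by (simp add: leech_coef_def leech_face_def leech_ob_def lobj_Cons_Suc)
    next
      case False
      \<comment> \<open>A face with \<open>j > 0\<close> keeps the object, so the identity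
        coefficient agrees with \<open>F\<close> of the identity morphism.\<close>
      then have "leech_ob (leech_face (Suc k) j ch) = leech_ob ch"
        using cell [OF j] by (simp add: cells_def)
      then show ?thesis
        using False x leech_ob_in_NN [OF ch] by (simp add: leech_coef_def Fm_id)
    qed
  next
    show "y \<in> carrier (chain_group (leech_chains n (Suc k)) leech_ob)"
      using y by (simp only: leech_complex_eq)
  qed (simp_all add: leech_ob_in_NN)
  then show ?thesis
    by (simp add: leech_diff_def leech_ob_def)
qed

lemma cube_complex_eq: "cube_complex n FG k = chain_group (Tn n k) ind"
  by (simp add: cube_complex_def chain_group_def)

lemma cube_diff_eq_tensor:
  assumes y: "y \<in> carrier (cube_complex n FG (Suc k))"
  shows "cube_diff n FG Fm (Suc k) y = tensor (Tn n (Suc k)) (Tn n k) ind cube_bd y"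
proof -
  have "face_sum (\<lambda>S. FG (ind S)) (Tn n (Suc k)) (Tn n k) ({1..Suc k} \<times> UNIV) cube_face (cube_coef Fm) cube_sign y
    = tensor (Tn n (Suc k)) (Tn n k) ind cube_bd y"
  proof (rule face_sum_eq_tensor [where f = cube_fst and g = cube_snd])
    show "cube_coef Fm se S x = Fm (ind (cube_face se S)) (cube_fst se S) (cube_snd se S) x" for se S x
      by (simp add: cube_coef_def cube_face_def cube_fst_def cube_snd_def Let_def)
    show "cube_bd S = (\<Sum>se\<in>{1..Suc k} \<times> UNIV.
        frag_cmul (cube_sign se) (frag_of (cube_face se S, cube_fst se S, cube_snd se S)))" if "S \<in> Tn n (Suc k)" for S
      using that by (rule cube_bd_eq_face_sum)
    show "(cube_face se S, cube_fst se S, cube_snd se S) \<in> cells n (Tn n k) ind (ind S)"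
      if "S \<in> Tn n (Suc k)" "se \<in> {1..Suc k} \<times> UNIV" for S se
      using that by (rule cube_face_cells)
    show "ind S \<in> NN n" if "S \<in> Tn n (Suc k)" for S
      using TnD [OF that] ind_in_NN by blast
    show "ind S \<in> NN n" if "S \<in> Tn n k" for S
      using TnD [OF that] ind_in_NN by blast
    show "y \<in> carrier (chain_group (Tn n (Suc k)) ind)"
      using y by (simp only: cube_complex_eq)
  qed simp
  then show ?thesis
    by (simp add: cube_diff_def)
qed

end

theorem mainTheorem2:
  fixes n :: nat
    and FG :: "(nat \<Rightarrow> nat) \<Rightarrow> 'a monoid"
    and Fm :: "(nat \<Rightarrow> nat) \<Rightarrow> (nat \<Rightarrow> nat) \<Rightarrow> (nat \<Rightarrow> nat) \<Rightarrow> 'a \<Rightarrow> 'a"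
  assumes "contra_natural_system n FG Fm"
  shows "\<forall>k. leech_homology n FG Fm k \<cong> cube_homology n FG Fm k"
proof
  fix k
  interpret natural_system n FG Fm
    using assms by unfold_locales
  show "leech_homology n FG Fm k \<cong> cube_homology n FG Fm k"
    unfolding leech_homology_def cube_homology_def
    by (rule acyclic_complexes_homology_iso [OF acyclic_leech acyclic_cube leech_complex_eq cube_complex_eq
          leech_diff_eq_tensor cube_diff_eq_tensor])
qed

end
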